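(* Let $m\ge2$ be an integer, let $N\ge1$ be an odd integer and let $M$ be an integer coprime to $N$, so that $\zeta_N^M=e^{2\pi iM/N}$ is a primitive $N$th root of unity with $N$ odd. Then the radial limit below exists and $$\lim_{q\to\zeta_N^M}\widetilde{\Psi}_m(q)=\zeta_N^{\frac{M(2m-3)^2}{8(2m-1)}}\,Z_{m,N}(\zeta_N^M).$$
   Context: Empty sums are $0$ and empty products are $1$. $(x)_n=(x;q)_n=\prod_{j=0}^{n-1}(1-xq^j)$. The Gaussian polynomial is $\begin{bmatrix} n\\k\end{bmatrix}=\frac{(q)_n}{(q)_{n-k}(q)_k}$ if $0\le k\le n$ and $0$ otherwise; it is a polynomial in $q$ and is evaluated at roots of unity as such. For $m\ge2$ and $|q|<1$, $$\widetilde{\Psi}_m(q)=\frac{2m-1}{2}\,q^{\frac{(2m-3)^2}{8(2m-1)}}\sum_{n_1,\dots,n_{m-1}\ge0}\frac{(-1)^{n_{m-1}}q^{\binom{n_{m-1}+1}{2}+\sum_{i=1}^{m-2}(n_i^2+n_i)}}{(-q)_{n_1}}\prod_{i=1}^{m-2}\begin{bmatrix} n_{i+1}\\ n_i\end{bmatrix},$$ and $$Z_{m,N}(q)=\sum_{n_1,\dots,n_{m-1}=0}^{N-1}\frac{(-1)^{n_{m-1}}q^{\binom{n_{m-1}+1}{2}+\sum_{i=1}^{m-2}(n_i^2+n_i)}}{(-q)_{n_1}}\prod_{i=1}^{m-2}\begin{bmatrix} n_{i+1}\\ n_i\end{bmatrix}.$$ Conventions: $\zeta_N=e^{2\pi i/N}$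 and $\zeta_N^{r}=e^{2\pi i r/N}$ for rational $r$. Write $q=e^{2\pi i\tau}$ with $\operatorname{Im}\tau>0$ and $q^r=e^{2\pi i r\tau}$ for rational $r$; $\lim_{q\to\zeta_N^M}$ denotes the radial limit from inside the unit disk, i.e. $\tau=\frac MN+i\frac{t}{2\pi}$ with $t\searrow0$. *)

theory Defs
  imports "HOL-Analysis.Analysis" "HOL-Computational_Algebra.Polynomial"
begin

definition qpoch :: "'a::comm_ring_1 \<Rightarrow> 'a \<Rightarrow> nat \<Rightarrow> 'a" where
  "qpoch x q n = (\<Prod>j<n. 1 - x * q ^ j)"

(* [:0, 1:] is the indeterminate; div is the division in the polynomial ring,
   which leaves no remainder here (lemma gaussian_poly_exact below). *)
definition gaussian_poly :: "nat \<Rightarrow> nat \<Rightarrow> complex poly" where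
  "gaussian_poly n k =
    (if k \<le> n
     then qpoch [:0, 1:] [:0, 1:] n div (qpoch [:0, 1:] [:0, 1:] (n - k) * qpoch [:0, 1:] [:0, 1:] k)
     else 0)"

lemma qpoch_Suc_self: "qpoch x x (Suc n) = qpoch x x n * (1 - x ^ Suc n)"
  by (simp add: qpoch_def)

lemma qpoch_self_dvd:
  fixes x :: "'a::comm_ring_1"
  shows "qpoch x x a * qpoch x x b dvd qpoch x x (a + b)"
proof (induction "a + b" arbitrary: a b)
  case 0
  then show ?case by (simp add: qpoch_def)
next
  case (Suc n)
  show ?case
  proof (cases "a = 0 \<or> b = 0")
    case True
    then show ?thesis by (auto simp: qpoch_def)
  next
    case False
    then obtain a' b' where ab: "a = Suc a'" "b = Suc b'"
      by (meson not0_implies_Suc)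
    have n: "n = a' + b" "n = a + b'"
      using Suc.hyps(2) ab by auto
    have "qpoch x x a * qpoch x x b dvd qpoch x x n * (1 - x ^ a)"
      using mult_dvd_mono[OF Suc.hyps(1)[OF n(1)] dvd_refl[of "1 - x ^ a"]] n(1) ab(1)
      by (simp add: qpoch_Suc_self mult_ac del: power_Suc)
    moreover have "qpoch x x a * qpoch x x b dvd qpoch x x n * (1 - x ^ b)"
      using mult_dvd_mono[OF Suc.hyps(1)[OF n(2)] dvd_refl[of "1 - x ^ b"]] n(2) ab(2)
      by (simp add: qpoch_Suc_self mult_ac del: power_Suc)
    ultimately have "qpoch x x a * qpoch x x b dvd
        qpoch x x n * (1 - x ^ a) + x ^ a * (qpoch x x n * (1 - x ^ b))"
      by (meson dvd_add dvd_mult)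
    also have "\<dots> = qpoch x x n * (1 - x ^ (a + b))"
      by (simp add: algebra_simps power_add)
    also have "\<dots> = qpoch x x (a + b)"
      by (metis Suc.hyps(2) qpoch_Suc_self)
    finally show ?thesis .
  qed
qed

lemma gaussian_poly_exact:
  assumes "k \<le> n"
  shows "gaussian_poly n k * (qpoch [:0, 1:] [:0, 1:] (n - k) * qpoch [:0, 1:] [:0, 1:] k)
       = qpoch [:0, 1:] [:0, 1:] n"
  using qpoch_self_dvd[of "[:0, 1:] :: complex poly" "n - k" k] assms
  by (simp add: gaussian_poly_def)

(* A tuple (n_1, ..., n_{m-1}) is a function n on {1..m-1}. *)
definition psi_term :: "nat \<Rightarrow> complex \<Rightarrow> (nat \<Rightarrow> nat) \<Rightarrow> complex" where
  "psi_term m q n =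
     (-1) ^ n (m - 1) * q ^ ((n (m - 1) + 1 choose 2) + (\<Sum>i=1..m-2. (n i)\<^sup>2 + n i))
       / qpoch (- q) q (n 1)
     * (\<Prod>i=1..m-2. poly (gaussian_poly (n (i + 1)) (n i)) q)"

(* e^{2 pi i r tau}, the paper's q^r for q = e^{2 pi i tau}; r = 1 gives q itself,
   and tau = 1/N gives zeta_N^r. *)
definition qpow :: "complex \<Rightarrow> real \<Rightarrow> complex" where
  "qpow \<tau> r = exp (2 * of_real pi * \<i> * of_real r * \<tau>)"

definition zeta_pow :: "nat \<Rightarrow> real \<Rightarrow> complex" where
  "zeta_pow N r = qpow (1 / of_nat N) r"

(* A function of tau rather than q, because of the fractional power of q.
   For Im tau > 0 the series converges absolutely. *)
definition psi_tilde :: "nat \<Rightarrow> complex \<Rightarrow> complex" where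
  "psi_tilde m \<tau> =
     of_real ((2 * real m - 1) / 2) * qpow \<tau> ((2 * real m - 3)\<^sup>2 / (8 * (2 * real m - 1)))
     * (\<Sum>\<^sub>\<infinity>n \<in> {1..m-1} \<rightarrow>\<^sub>E UNIV. psi_term m (qpow \<tau> 1) n)"

definition Z :: "nat \<Rightarrow> nat \<Rightarrow> complex \<Rightarrow> complex" where
  "Z m N q = (\<Sum>n \<in> {1..m-1} \<rightarrow>\<^sub>E {0..<N}. psi_term m q n)"

end

theory Submission
  imports Defs "HOL-Complex_Analysis.Conformal_Mappings"
begin

text \<open>
  Write \<open>i = m - 2\<close> and \<open>K = 2 m - 1 = 2 i + 3\<close>, and let \<open>\<zeta>\<close> be the root of unity, of odd
  order \<open>N\<close>. The multisum in \<open>psi_tilde\<close> is a single sum over its top index \<open>n\<close>, whose summand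
  contains the inner sums (\<open>chain_beta\<close>). At \<open>q = \<zeta>\<close> the Gaussian polynomials satisfy
  \<open>[n + N, k] = [n, k] + [n, k - N]\<close>, which makes this summand quasi-periodic: a shift of \<open>n\<close>
  by \<open>N\<close> multiplies it by \<open>- (2 m - 3) / 2\<close>. Formally, the series at \<open>\<zeta>\<close> is therefore \<open>Z\<close> times a
  geometric series with sum \<open>2 / K\<close>, and this explains the factor \<open>K / 2\<close>. The geometric series
  diverges for \<open>m > 2\<close>, however, so this does not compute a limit by itself.

  The remedy is a deformation by a parameter \<open>y\<close>. Put \<open>a = q y^2\<close>, replace \<open>1 / (-q)_n\<close> by
  \<open>1 / (-q y)_n\<close>, and give each summation index \<open>n\<close> an additional factor \<open>y ^ (2 n)\<close>. The Bailey
  lemma relative to \<open>a\<close> then evaluates the deformed multisum for \<open>|q| < 1\<close> as the false theta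
  function \<open>\<Sum>r. y ^ (K r) q ^ e(r) (1 - y^2 q ^ (2 r + 1))\<close> with
  \<open>e(r) = (m - 1) (r^2 + r) + r (r - 1) / 2\<close> (\<open>false_theta_identity\<close>). The argument \<open>q y\<close> of the
  seed is the square root of \<open>a q\<close>; it is chosen because then the right-hand side contains
  no quotients of Pochhammer symbols.

  For small \<open>y\<close> both sides converge uniformly up to the unit circle, so the identity holds at
  \<open>q = \<zeta>\<close>. There both sides are geometric in blocks of length \<open>N\<close>, and the identity becomes one
  between rational functions of \<open>y\<close>, which persists for all regular \<open>y\<close> (\<open>block_identity\<close>).
  Both sides vanish at \<open>y = 1\<close>, and comparing their derivatives there expresses \<open>Z\<close> through a
  finite sum over one period of the false theta function (\<open>sum_psi_summand_one\<close>).

  On the other hand \<open>y = 1\<close> is allowed inside the disk, so \<open>psi_tilde\<close> is \<open>K / 2\<close> times a power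
  of \<open>q\<close> times the false theta function at \<open>y = 1\<close>. Along the radius this is a
  sum of a periodic sequence against the Gaussian-like weights \<open>exp (- t e(r))\<close>. Two summations by
  parts show that it tends to the same finite sum (\<open>periodic_gaussian_limit\<close>).
\<close>

section \<open>Bounds for q-Pochhammer symbols\<close>

lemma qpoch_0 [simp]: "qpoch x q 0 = 1"
  by (simp add: qpoch_def)

lemma qpoch_Suc: "qpoch x q (Suc n) = qpoch x q n * (1 - x * q ^ n)"
  by (simp add: qpoch_def)

lemma qpoch_add: "qpoch x q (n + k) = qpoch x q n * qpoch (x * q ^ n) q k"
  by (induction k) (simp_all add: qpoch_Suc power_add mult_ac)

lemma qpoch_Suc_left: "qpoch x q (Suc n) = (1 - x) * qpoch (x * q) q n"
  using qpoch_add[of x q 1 n] by (simp add: qpoch_Suc)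

lemma norm_mult_power_le:
  fixes x q :: complex
  assumes "norm q \<le> 1"
  shows "norm (x * q ^ j) \<le> norm x"
  using assms by (simp add: norm_mult norm_power mult_left_le power_le_one)

lemma norm_qpoch_ge:
  fixes x q :: complex
  assumes "norm x \<le> r" "r \<le> 1" "norm q \<le> 1"
  shows "norm (qpoch x q n) \<ge> (1 - r) ^ n"
proof (induction n)
  case (Suc n)
  have "1 - r \<le> norm (1 - x * q ^ n)"
    using norm_mult_power_le[OF assms(3), of x n] assms(1) norm_triangle_ineq2[of 1 "x * q ^ n"]
    by simp
  then have "(1 - r) ^ n * (1 - r) \<le> norm (qpoch x q n) * norm (1 - x * q ^ n)"
    using Suc assms(2) by (intro mult_mono) auto
  then show ?case
    by (simp add: qpoch_Suc norm_mult mult.commute)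
qed simp

lemma norm_qpoch_le:
  fixes x q :: complex
  assumes "norm x \<le> 1" "norm q \<le> 1"
  shows "norm (qpoch x q n) \<le> 2 ^ n"
proof (induction n)
  case (Suc n)
  have "norm (1 - x * q ^ n) \<le> 2"
    using norm_mult_power_le[OF assms(2), of x n] assms(1) norm_triangle_ineq4[of 1 "x * q ^ n"]
    by simp
  then have "norm (qpoch x q n) * norm (1 - x * q ^ n) \<le> 2 ^ n * 2"
    using Suc by (intro mult_mono) auto
  then show ?case
    by (simp add: qpoch_Suc norm_mult mult.commute)
qed simp

lemma qpoch_nonzero:
  fixes x q :: complex
  assumes "norm x < 1" "norm q \<le> 1"
  shows "qpoch x q n \<noteq> 0"
proof -
  have "0 < (1 - norm x) ^ n"
    using assms(1) by simp
  also have "\<dots> \<le> norm (qpoch x q n)"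
    using norm_qpoch_ge[of x "norm x" q n] assms by simp
  finally show ?thesis by auto
qed

lemma norm_inverse_qpoch_le:
  fixes x q :: complex
  assumes "norm x \<le> r" "r < 1" "norm q \<le> 1"
  shows "norm (1 / qpoch x q n) \<le> (1 / (1 - r)) ^ n"
proof -
  have "0 < (1 - r) ^ n"
    using assms(2) by simp
  moreover have "(1 - r) ^ n \<le> norm (qpoch x q n)"
    using assms by (intro norm_qpoch_ge) auto
  ultimately show ?thesis
    by (simp add: norm_divide power_divide frac_le)
qed

lemma one_minus_nonzero:
  fixes x q :: complex
  assumes "norm x < 1" "norm q \<le> 1"
  shows "1 - x * q ^ n \<noteq> 0"
  using norm_mult_power_le[OF assms(2), of x n] assms(1) by auto

section \<open>Gaussian polynomials\<close>

text \<open>Evaluating the polynomial, rather than a quotient of Pochhammer symbols, keeps Pascal's rule valid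
  at roots of unity, where the quotient formula breaks down.\<close>

definition gauss_binom :: "complex \<Rightarrow> nat \<Rightarrow> nat \<Rightarrow> complex" where
  "gauss_binom q n k = poly (gaussian_poly n k) q"

lemma poly_qpoch: "poly (qpoch [:0, 1:] [:0, 1:] n) q = qpoch q q n"
  by (induction n) (simp_all add: qpoch_Suc)

lemma qpoch_X_nonzero: "qpoch [:0, 1:] [:0, 1:] n \<noteq> (0 :: complex poly)"
proof
  assume "qpoch [:0, 1:] [:0, 1:] n = (0 :: complex poly)"
  then have "qpoch (0::complex) 0 n = 0"
    by (metis poly_qpoch poly_0)
  then show False by (simp add: qpoch_def)
qed

lemma gaussian_poly_self [simp]: "gaussian_poly n n = 1"
  using qpoch_X_nonzero[of n] by (simp add: gaussian_poly_def)

lemma gaussian_poly_Suc_Suc: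
  "gaussian_poly (Suc n) (Suc k) = gaussian_poly n k + [:0, 1:] ^ Suc k * gaussian_poly n (Suc k)"
proof (cases "k < n")
  case True
  define Q where "Q = (qpoch [:0, 1:] [:0, 1:] :: nat \<Rightarrow> complex poly)"
  define X where "X = ([:0, 1:] :: complex poly)"
  have QS: "Q (Suc j) = Q j * (1 - X ^ Suc j)" for j
    by (simp add: Q_def X_def qpoch_Suc)
  obtain d where d: "n = Suc (k + d)"
    using True less_iff_Suc_add by auto
  have e1: "gaussian_poly (Suc n) (Suc k) * (Q (Suc d) * Q (Suc k)) = Q (Suc n)"
    using gaussian_poly_exact[of "Suc k" "Suc n"] by (simp add: d Q_def)
  have e2: "gaussian_poly n k * (Q (Suc d) * Q k) = Q n"
    using gaussian_poly_exact[of k n] by (simp add: d Q_def Suc_diff_le)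
  have e3: "gaussian_poly n (Suc k) * (Q d * Q (Suc k)) = Q n"
    using gaussian_poly_exact[of "Suc k" n] by (simp add: d Q_def)
  have "(gaussian_poly n k + X ^ Suc k * gaussian_poly n (Suc k)) * (Q (Suc d) * Q (Suc k))
      = gaussian_poly n k * (Q (Suc d) * Q k) * (1 - X ^ Suc k)
        + X ^ Suc k * (gaussian_poly n (Suc k) * (Q d * Q (Suc k))) * (1 - X ^ Suc d)"
    by (simp add: QS algebra_simps del: power_Suc)
  also have "\<dots> = Q n * (1 - X ^ Suc k * X ^ Suc d)"
    unfolding e2 e3 by (simp add: algebra_simps)
  also have "\<dots> = Q (Suc n)"
    unfolding QS by (simp add: d power_add mult_ac)
  finally have "(gaussian_poly n k + X ^ Suc k * gaussian_poly n (Suc k)) * (Q (Suc d) * Q (Suc k))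
      = gaussian_poly (Suc n) (Suc k) * (Q (Suc d) * Q (Suc k))"
    using e1 by simp
  moreover have "Q (Suc d) * Q (Suc k) \<noteq> 0"
    using qpoch_X_nonzero by (simp add: Q_def)
  ultimately show ?thesis
    by (simp add: X_def)
next
  case False
  then show ?thesis
    by (cases "n = k") (simp_all add: gaussian_poly_def[of _ "Suc _"] gaussian_poly_def[of n k])
qed

lemma gauss_binom_Suc_Suc:
  "gauss_binom q (Suc n) (Suc k) = gauss_binom q n k + q ^ Suc k * gauss_binom q n (Suc k)"
  by (simp add: gauss_binom_def gaussian_poly_Suc_Suc)

lemma gauss_binom_eq_0 [simp]: "n < k \<Longrightarrow> gauss_binom q n k = 0"
  by (simp add: gauss_binom_def gaussian_poly_def)

lemma gauss_binom_self [simp]: "gauss_binom q n n = 1"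
  by (simp add: gauss_binom_def)

lemma gauss_binom_0 [simp]: "gauss_binom q n 0 = 1"
  using qpoch_X_nonzero[of n] by (simp add: gauss_binom_def gaussian_poly_def)

lemma gauss_binom_exact:
  assumes "k \<le> n"
  shows "gauss_binom q n k * (qpoch q q (n - k) * qpoch q q k) = qpoch q q n"
  using arg_cong[OF gaussian_poly_exact[OF assms], of "\<lambda>p. poly p q"]
  by (simp add: gauss_binom_def poly_qpoch)

lemma gauss_binom_eq:
  assumes "k \<le> n" "norm q < 1"
  shows "gauss_binom q n k = qpoch q q n / (qpoch q q (n - k) * qpoch q q k)"
  using gauss_binom_exact[OF assms(1), of q] qpoch_nonzero[of q q] assms(2)
  by (simp add: field_simps)

lemma norm_gauss_binom_le:
  assumes "norm q \<le> 1"
  shows "norm (gauss_binom q n k) \<le> of_nat (n choose k)"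
proof (induction n arbitrary: k)
  case 0
  show ?case by (cases k) auto
next
  case (Suc n)
  show ?case
  proof (cases k)
    case (Suc j)
    have "norm (q ^ Suc j * gauss_binom q n (Suc j)) \<le> norm (gauss_binom q n (Suc j))"
      using norm_mult_power_le[OF assms, of "gauss_binom q n (Suc j)" "Suc j"]
      by (simp add: mult.commute)
    then have "norm (gauss_binom q (Suc n) k)
        \<le> norm (gauss_binom q n j) + norm (gauss_binom q n (Suc j))"
      unfolding Suc gauss_binom_Suc_Suc using norm_triangle_mono by blast
    also have "\<dots> \<le> of_nat (n choose j) + of_nat (n choose Suc j)"
      using Suc.IH[of j] Suc.IH[of "Suc j"] by simp
    finally show ?thesis by (simp add: Suc)
  qed simp
qed

text \<open>
  Pascal's rule, summed against an arbitrary sequence. In this form an induction on the row needs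
  only a termwise identity for the sequence.
\<close>

lemma sum_gauss_binom_Suc:
  "(\<Sum>k\<le>Suc n. gauss_binom q (Suc n) k * h k)
     = (\<Sum>k\<le>n. gauss_binom q n k * (q ^ k * h k + h (Suc k)))"
proof -
  have "(\<Sum>k\<le>Suc n. gauss_binom q (Suc n) k * h k)
      = h 0 + (\<Sum>k\<le>n. gauss_binom q (Suc n) (Suc k) * h (Suc k))"
    by (subst sum.atMost_Suc_shift) simp
  also have "\<dots> = (h 0 + (\<Sum>k\<le>n. q ^ Suc k * gauss_binom q n (Suc k) * h (Suc k)))
      + (\<Sum>k\<le>n. gauss_binom q n k * h (Suc k))"
    by (simp add: gauss_binom_Suc_Suc algebra_simps sum.distrib)
  also have "h 0 + (\<Sum>k\<le>n. q ^ Suc k * gauss_binom q n (Suc k) * h (Suc k))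
      = (\<Sum>k\<le>Suc n. q ^ k * gauss_binom q n k * h k)"
    using sum.atMost_Suc_shift[of "\<lambda>k. q ^ k * gauss_binom q n k * h k" n] by simp
  also have "\<dots> = (\<Sum>k\<le>n. q ^ k * gauss_binom q n k * h k)"
    by simp
  finally show ?thesis
    by (simp add: algebra_simps sum.distrib)
qed

text \<open>The finite q-binomial theorem. It serves to evaluate a Pochhammer symbol over a full period
  at a root of unity, where all inner coefficients vanish.\<close>

lemma qpoch_eq_sum_gauss_binom:
  "qpoch z q n = (\<Sum>k\<le>n. gauss_binom q n k * ((-z) ^ k * q ^ (k choose 2)))"
proof (induction n arbitrary: z)
  case (Suc n)
  have "q ^ k * ((-z) ^ k * q ^ (k choose 2)) + (-z) ^ Suc k * q ^ (Suc k choose 2)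
      = (1 - z) * ((-(z * q)) ^ k * q ^ (k choose 2))" for k
  proof -
    have "(Suc k choose 2) = (k choose 2) + k"
      by (simp add: numeral_2_eq_2)
    moreover have "(-(z * q)) ^ k = (-z) ^ k * q ^ k"
      by (metis mult_minus_left power_mult_distrib)
    ultimately show ?thesis
      by (simp add: power_add algebra_simps)
  qed
  then show ?case
    unfolding sum_gauss_binom_Suc
    by (simp add: qpoch_Suc_left Suc.IH sum_distrib_left mult_ac)
qed (simp add: numeral_2_eq_2)

section \<open>The Bailey lemma\<close>

text \<open>A finite form of Cauchy's identity (dissection of a partition by its Durfee square). Pascal's
  rule reduces row \<open>n + 1\<close> at \<open>b\<close> to row \<open>n\<close> at \<open>b q\<close>, because the two terms with the same
  coefficient add up to a term of the shifted sum. This is the summation behind one step of the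
  Bailey chain.\<close>

lemma sum_gauss_binom_durfee:
  assumes "norm q < 1" "norm b \<le> 1"
  shows "(\<Sum>k\<le>n. gauss_binom q n k * (b ^ k * q ^ k\<^sup>2 / qpoch (b * q) q k)) = 1 / qpoch (b * q) q n"
  using assms(2)
proof (induction n arbitrary: b)
  case (Suc n)
  have bq: "norm (b * q) < 1" "norm (b * q) \<le> 1"
    using assms(1) Suc.prems mult_le_one[of "norm b" "norm q"]
    by (auto simp: norm_mult) (meson le_less_trans mult_left_le_one_le norm_ge_zero)
  have bqq: "norm (b * q * q) < 1"
    using norm_mult_power_le[of q "b * q" 1] bq(1) assms(1) by simp
  have step: "q ^ k * (b ^ k * q ^ k\<^sup>2 / qpoch (b * q) q k)
        + b ^ Suc k * q ^ (Suc k)\<^sup>2 / qpoch (b * q) q (Suc k)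
      = 1 / (1 - b * q) * ((b * q) ^ k * q ^ k\<^sup>2 / qpoch (b * q * q) q k)" for k
  proof -
    have nz: "qpoch (b * q) q k \<noteq> 0" "1 - b * q * q ^ k \<noteq> 0" "1 - b * q \<noteq> 0"
        "qpoch (b * q * q) q k \<noteq> 0"
      using qpoch_nonzero[of "b * q" q] one_minus_nonzero[of "b * q" q k]
        one_minus_nonzero[of "b * q" q 0] qpoch_nonzero[of "b * q * q" q] bq bqq assms(1)
      by simp_all
    have "qpoch (b * q) q k * (1 - b * q * q ^ k) = (1 - b * q) * qpoch (b * q * q) q k"
      by (metis qpoch_Suc qpoch_Suc_left)
    moreover have "q ^ k * (b ^ k * q ^ k\<^sup>2 / qpoch (b * q) q k)
        + b ^ Suc k * q ^ (Suc k)\<^sup>2 / qpoch (b * q) q (Suc k)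
      = (b * q) ^ k * q ^ k\<^sup>2 / (qpoch (b * q) q k * (1 - b * q * q ^ k))"
      using nz by (simp add: qpoch_Suc field_simps power2_eq_square power_add power_mult_distrib)
    ultimately show ?thesis
      by simp
  qed
  have "(\<Sum>k\<le>n. gauss_binom q n k
        * (1 / (1 - b * q) * ((b * q) ^ k * q ^ k\<^sup>2 / qpoch (b * q * q) q k)))
      = 1 / (1 - b * q)
        * (\<Sum>k\<le>n. gauss_binom q n k * ((b * q) ^ k * q ^ k\<^sup>2 / qpoch (b * q * q) q k))"
    by (simp add: sum_distrib_left mult_ac)
  then show ?case
    unfolding sum_gauss_binom_Suc step Suc.IH[OF bq(2)]
    by (simp add: qpoch_Suc_left)
qed simp

lemma sum_atMost_triangle_swap:
  fixes g :: "nat \<Rightarrow> nat \<Rightarrow> 'a::comm_monoid_add"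
  shows "(\<Sum>j\<le>n. \<Sum>r\<le>j. g j r) = (\<Sum>r\<le>n. \<Sum>k\<le>n - r. g (r + k) r)"
  unfolding sum.Sigma[OF finite_atMost ballI[OF finite_atMost]]
  by (rule sum.reindex_bij_witness[where j = "\<lambda>(j, r). (r, j - r)" and i = "\<lambda>(r, k). (r + k, r)"])
     auto

text \<open>\<open>\<beta> n = bailey_sum a q \<alpha> n\<close> says that \<open>(\<alpha>, \<beta>)\<close> is a Bailey pair relative to \<open>a\<close>.\<close>

definition bailey_sum :: "complex \<Rightarrow> complex \<Rightarrow> (nat \<Rightarrow> complex) \<Rightarrow> nat \<Rightarrow> complex" where
  "bailey_sum a q \<alpha> n = (\<Sum>r\<le>n. \<alpha> r / (qpoch q q (n - r) * qpoch (a * q) q (n + r)))"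

text \<open>One step of the Bailey chain: the left-hand side is the next inner sum of the multisum, and its
  effect on \<open>\<alpha>\<close> is merely a factor \<open>a ^ r q ^ r\<^sup>2\<close>. The factors \<open>qpoch q q\<close> turn the usual
  denominators \<open>(q)_{n - j}\<close> into Gaussian coefficients.\<close>

lemma bailey_step:
  assumes "norm q < 1" "norm a \<le> 1"
  shows "(\<Sum>j\<le>n. gauss_binom q n j * (a ^ j * q ^ j\<^sup>2) * (qpoch q q j * bailey_sum a q \<alpha> j))
       = qpoch q q n * bailey_sum a q (\<lambda>r. a ^ r * q ^ r\<^sup>2 * \<alpha> r) n"
proof -
  have Q: "qpoch q q j \<noteq> 0" for j
    using qpoch_nonzero[of q q] assms by simp
  have "gauss_binom q n j * (a ^ j * q ^ j\<^sup>2) * (qpoch q q j * bailey_sum a q \<alpha> j)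
      = (\<Sum>r\<le>j. qpoch q q n / qpoch q q (n - j) * (a ^ j * q ^ j\<^sup>2)
            * (\<alpha> r / (qpoch q q (j - r) * qpoch (a * q) q (j + r))))" if "j \<le> n" for j
    using Q that assms(1) by (simp add: bailey_sum_def gauss_binom_eq sum_distrib_left mult.assoc)
  then have "(\<Sum>j\<le>n. gauss_binom q n j * (a ^ j * q ^ j\<^sup>2) * (qpoch q q j * bailey_sum a q \<alpha> j))
      = (\<Sum>j\<le>n. \<Sum>r\<le>j. qpoch q q n / qpoch q q (n - j) * (a ^ j * q ^ j\<^sup>2)
            * (\<alpha> r / (qpoch q q (j - r) * qpoch (a * q) q (j + r))))"
    by simp
  also have "\<dots> = (\<Sum>r\<le>n. \<Sum>k\<le>n - r. qpoch q q n / qpoch q q (n - (r + k))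
            * (a ^ (r + k) * q ^ (r + k)\<^sup>2) * (\<alpha> r / (qpoch q q k * qpoch (a * q) q (r + k + r))))"
    by (subst sum_atMost_triangle_swap) simp
  also have "\<dots> = (\<Sum>r\<le>n. qpoch q q n * (a ^ r * q ^ r\<^sup>2 * \<alpha> r)
      / (qpoch q q (n - r) * qpoch (a * q) q (2 * r))
      * (\<Sum>k\<le>n - r. gauss_binom q (n - r) k
            * ((a * q ^ (2 * r)) ^ k * q ^ k\<^sup>2 / qpoch (a * q ^ (2 * r) * q) q k)))"
  proof (rule sum.cong[OF refl], subst sum_distrib_left, rule sum.cong[OF refl])
    fix r k assume "r \<in> {..n}" "k \<in> {..n - r}"
    then have k: "k \<le> n - r" "n - (r + k) = n - r - k" by auto
    have "qpoch (a * q) q (r + k + r)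
        = qpoch (a * q) q (2 * r) * qpoch (a * q ^ (2 * r) * q) q k"
      using qpoch_add[of "a * q" q "2 * r" k] by (simp add: mult_ac add_ac mult_2[symmetric])
    moreover have "a ^ (r + k) * q ^ (r + k)\<^sup>2
        = (a ^ r * q ^ r\<^sup>2) * ((a * q ^ (2 * r)) ^ k * q ^ k\<^sup>2)"
      by (simp add: power_add power2_sum power_mult_distrib power_mult[symmetric] mult_ac)
    ultimately show "qpoch q q n / qpoch q q (n - (r + k)) * (a ^ (r + k) * q ^ (r + k)\<^sup>2)
          * (\<alpha> r / (qpoch q q k * qpoch (a * q) q (r + k + r)))
        = qpoch q q n * (a ^ r * q ^ r\<^sup>2 * \<alpha> r) / (qpoch q q (n - r) * qpoch (a * q) q (2 * r))
          * (gauss_binom q (n - r) k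
            * ((a * q ^ (2 * r)) ^ k * q ^ k\<^sup>2 / qpoch (a * q ^ (2 * r) * q) q k))"
      unfolding gauss_binom_eq[OF k(1) assms(1)] k(2) using Q[of "n - r"] by (simp add: mult_ac)
  qed
  also have "\<dots> = (\<Sum>r\<le>n. qpoch q q n * (a ^ r * q ^ r\<^sup>2 * \<alpha> r)
      / (qpoch q q (n - r) * qpoch (a * q) q (n + r)))"
  proof (rule sum.cong[OF refl])
    fix r assume "r \<in> {..n}"
    then have "n + r = 2 * r + (n - r)" by auto
    then have "qpoch (a * q) q (n + r) = qpoch (a * q) q (2 * r + (n - r))"
      by (rule arg_cong)
    then have "qpoch (a * q) q (n + r)
        = qpoch (a * q) q (2 * r) * qpoch (a * q ^ (2 * r) * q) q (n - r)"
      unfolding qpoch_add by (simp add: mult_ac)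
    moreover have "norm (a * q ^ (2 * r)) \<le> 1"
      using norm_mult_power_le[of q a "2 * r"] assms by simp
    ultimately show "qpoch q q n * (a ^ r * q ^ r\<^sup>2 * \<alpha> r)
      / (qpoch q q (n - r) * qpoch (a * q) q (2 * r))
      * (\<Sum>k\<le>n - r. gauss_binom q (n - r) k
            * ((a * q ^ (2 * r)) ^ k * q ^ k\<^sup>2 / qpoch (a * q ^ (2 * r) * q) q k))
      = qpoch q q n * (a ^ r * q ^ r\<^sup>2 * \<alpha> r) / (qpoch q q (n - r) * qpoch (a * q) q (n + r))"
      using sum_gauss_binom_durfee[OF assms(1), of "a * q ^ (2 * r)" "n - r"] by simp
  qed
  finally show ?thesis
    by (simp add: bailey_sum_def sum_distrib_left)
qed

text \<open>The sequence that forms a Bailey pair relative to \<open>a = q y\<^sup>2\<close> with \<open>1 / ((q)_n (- q y)_n)\<close>. It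
  arises from the unit Bailey pair with one parameter equal to \<open>- sqrt (a q) = - q y\<close> and the
  other tending to infinity.\<close>

definition seed_alpha :: "complex \<Rightarrow> complex \<Rightarrow> nat \<Rightarrow> complex" where
  "seed_alpha q y r =
     (1 - q * y\<^sup>2 * q ^ (2 * r)) / (1 - q * y\<^sup>2) * (qpoch (q * y\<^sup>2) q r / qpoch q q r)
     * ((-y) ^ r * q ^ r\<^sup>2)"

lemma norm_q_y2:
  fixes q y :: complex
  assumes "norm q < 1" "norm y \<le> 1"
  shows "norm (q * y\<^sup>2) < 1" "norm (q * y) < 1"
proof -
  have "norm (q * z) < 1" if "norm z \<le> 1" for z :: complex
    using assms(1) mult_left_le[OF that norm_ge_zero[of q]] by (simp add: norm_mult)
  then show "norm (q * y\<^sup>2) < 1" "norm (q * y) < 1"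
    using assms(2) by (simp_all add: norm_power power_le_one)
qed

text \<open>A creative telescoping step: the difference of both sides is \<open>\<Sum>r\<le>n. T' r - T r\<close>, where \<open>T' r\<close> is
  \<open>T (r + 1)\<close> in disguise. Combined with the fact that the right-hand side is the Bailey sum at
  \<open>n - 1\<close>, it determines the Bailey sum of the seed by induction.\<close>

lemma seed_alpha_recurrence:
  assumes q: "norm q < 1" and y: "norm y \<le> 1"
  defines "a \<equiv> q * y\<^sup>2"
  shows "(1 - q ^ n) * (1 + y * q ^ n) * bailey_sum a q (seed_alpha q y) n
       = (\<Sum>r\<le>n. (1 - q ^ (n - r)) * (1 - a * q ^ (n + r))
            * (seed_alpha q y r / (qpoch q q (n - r) * qpoch (a * q) q (n + r))))"
proof -
  define F where "F r = seed_alpha q y r / (qpoch q q (n - r) * qpoch (a * q) q (n + r))" for r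
  \<comment> \<open>The certificate: \<open>T r\<close> is a rational multiple of the summand \<open>F r\<close> that
    vanishes for \<open>r = 0\<close>, and \<open>T' r\<close> is \<open>T (r + 1)\<close> rewritten as a multiple of \<open>F r\<close>, so that
    it makes sense, and vanishes, for \<open>r = n\<close>.\<close>
  define T where "T r = - (F r * (1 - q ^ r) * (1 - a * q ^ (n + r)) * q ^ (n - r) * (1 + y * q ^ r)
      / (1 - a * q ^ (2 * r)))" for r
  define T' where "T' r = F r * (1 - a * q ^ r) * (1 - q ^ (n - r)) * (y * q ^ (n + r))
      * (1 + y * q ^ Suc r) / (1 - a * q ^ (2 * r))" for r
  have a: "norm a < 1" "norm (a * q) < 1"
    using norm_q_y2[OF q y] norm_mult_power_le[of q a 1] q by (simp_all add: a_def)
  have nz: "qpoch q q j \<noteq> 0" "qpoch (a * q) q j \<noteq> 0" "1 - a * q ^ j \<noteq> 0" "1 - q * q ^ j \<noteq> 0" for j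
    using qpoch_nonzero one_minus_nonzero q a by simp_all
  have nz1: "1 - a \<noteq> 0"
    using nz(3)[of 0] by simp
  have FT: "F r * ((1 - q ^ n) * (1 + y * q ^ n) - (1 - q ^ (n - r)) * (1 - a * q ^ (n + r)))
      = T' r - T r" if "r \<le> n" for r
  proof -
    \<comment> \<open>In terms of \<open>p\<close> and \<open>X\<close> the claim is an identity of rational functions.\<close>
    define p X where "p = q ^ (n - r)" and "X = q ^ r"
    have pX: "q ^ n = p * X" "q ^ (n + r) = p * X\<^sup>2" "q ^ (2 * r) = X\<^sup>2"
      using that by (simp_all add: p_def X_def power_add[symmetric] mult_2 power2_eq_square)
    have "((1 - p * X) * (1 + y * (p * X)) - (1 - p) * (1 - a * (p * X\<^sup>2))) * (1 - a * X\<^sup>2)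
        = (1 - a * X) * (1 - p) * (y * (p * X\<^sup>2)) * (1 + y * (q * X))
          + (1 - X) * (1 - a * (p * X\<^sup>2)) * p * (1 + y * X)"
      unfolding a_def by algebra
    then have "(1 - p * X) * (1 + y * (p * X)) - (1 - p) * (1 - a * (p * X\<^sup>2))
        = ((1 - a * X) * (1 - p) * (y * (p * X\<^sup>2)) * (1 + y * (q * X))
          + (1 - X) * (1 - a * (p * X\<^sup>2)) * p * (1 + y * X)) / (1 - a * X\<^sup>2)"
      using nz(3)[of "2 * r"] pX(3) by (simp add: nonzero_eq_divide_eq)
    moreover have "f * ((A * B * C * D + E * G * p * H) / d)
        = f * A * B * C * D / d - - (f * E * G * p * H / d)" for f A B C D E G H d :: complex
      by (simp add: add_divide_distrib distrib_left mult_ac)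
    ultimately show ?thesis
      unfolding T_def T'_def pX p_def[symmetric] X_def[symmetric] power_Suc by simp
  qed
  have TT: "T' r = T (Suc r)" if r: "r < n" for r
  proof -
    obtain d where d: "n = Suc (r + d)"
      using r less_iff_Suc_add by auto
    have s: "seed_alpha q y (Suc r) / (1 - a * q ^ (2 * Suc r)) * (1 - q ^ Suc r)
        = seed_alpha q y r / (1 - a * q ^ (2 * r)) * (1 - a * q ^ r) * (- y * q ^ (2 * r + 1))"
    proof -
      have e: "(-y) ^ Suc r * q ^ (Suc r)\<^sup>2 = (-y) ^ r * q ^ r\<^sup>2 * (- y * q ^ (2 * r + 1))"
        by (simp add: power2_eq_square power_add mult_2)
      show ?thesis
        using nz(3)[of "2 * r"] nz(3)[of "2 * Suc r"] nz(1) nz(4)[of r] nz1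
        unfolding seed_alpha_def a_def[symmetric] e
        by (simp add: qpoch_Suc divide_simps del: mult_Suc_right)
    qed
    have "T (Suc r) = - (seed_alpha q y (Suc r) / (1 - a * q ^ (2 * Suc r)) * (1 - q ^ Suc r))
        * (1 - a * q ^ (n + Suc r)) * q ^ d * (1 + y * q ^ Suc r)
        / (qpoch q q d * (qpoch (a * q) q (n + r) * (1 - a * q ^ (n + Suc r))))"
      by (simp add: T_def F_def d qpoch_Suc mult_ac)
    also have "\<dots> = seed_alpha q y r / (1 - a * q ^ (2 * r)) * (1 - a * q ^ r) * (y * q ^ (2 * r + 1))
        * q ^ d * (1 + y * q ^ Suc r) / (qpoch q q d * qpoch (a * q) q (n + r))"
      unfolding s using nz(3)[of "n + Suc r"] by simp
    also have "\<dots> = T' r"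
      using nz(4)[of d]
      by (simp add: T'_def F_def d qpoch_Suc power_add mult_2 Suc_diff_le mult_ac)
         (simp add: power_mult power2_eq_square)
    finally show ?thesis by simp
  qed
  have "T' n = 0" "T 0 = 0"
    by (simp_all add: T_def T'_def)
  then have "(\<Sum>r\<le>n. T' r) = (\<Sum>r\<le>n. T r)"
    using TT by (simp add: lessThan_Suc_atMost[symmetric] sum.lessThan_Suc_shift[of T]
        sum.lessThan_Suc[of T'] del: sum.lessThan_Suc)
  then have "(\<Sum>r\<le>n. F r * ((1 - q ^ n) * (1 + y * q ^ n) - (1 - q ^ (n - r)) * (1 - a * q ^ (n + r)))) = 0"
    using FT by (simp add: sum_subtractf)
  then have "(1 - q ^ n) * (1 + y * q ^ n) * (\<Sum>r\<le>n. F r)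
      = (\<Sum>r\<le>n. (1 - q ^ (n - r)) * (1 - a * q ^ (n + r)) * F r)"
    unfolding right_diff_distrib[of "F _"] sum_subtractf sum_distrib_left
    by (simp add: mult.commute)
  then show ?thesis
    by (simp add: bailey_sum_def F_def)
qed

lemma bailey_seed:
  assumes q: "norm q < 1" and y: "norm y \<le> 1"
  shows "qpoch q q n * bailey_sum (q * y\<^sup>2) q (seed_alpha q y) n = 1 / qpoch (- (q * y)) q n"
proof (induction n)
  case 0
  show ?case
    using one_minus_nonzero[OF norm_q_y2(1)[OF q y], of q 0] q by (simp add: bailey_sum_def seed_alpha_def)
next
  case (Suc n)
  define a where "a = q * y\<^sup>2"
  define \<alpha> where "\<alpha> = seed_alpha q y"
  have a: "norm a < 1" "norm (a * q) < 1"
    using norm_q_y2[OF q y] norm_mult_power_le[of q a 1] q by (simp_all add: a_def)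
  have nz: "1 - a * q ^ j \<noteq> 0" "1 - q * q ^ j \<noteq> 0" "1 + y * q ^ Suc n \<noteq> 0" for j
    using one_minus_nonzero[of a q] one_minus_nonzero[of q q]
      one_minus_nonzero[of "-(q * y)" q n] norm_q_y2[OF q y] q a by (simp_all add: mult_ac)
  have "(1 - q ^ Suc n) * (1 + y * q ^ Suc n) * bailey_sum a q \<alpha> (Suc n)
      = (\<Sum>r\<le>Suc n. (1 - q ^ (Suc n - r)) * (1 - a * q ^ (Suc n + r))
            * (\<alpha> r / (qpoch q q (Suc n - r) * qpoch (a * q) q (Suc n + r))))"
    unfolding a_def \<alpha>_def by (rule seed_alpha_recurrence[OF q y])
  also have "\<dots> = (\<Sum>r\<le>n. (1 - q ^ (Suc n - r)) * (1 - a * q ^ (Suc n + r))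
            * (\<alpha> r / (qpoch q q (Suc n - r) * qpoch (a * q) q (Suc n + r))))"
    by simp
  also have "\<dots> = bailey_sum a q \<alpha> n"
    unfolding bailey_sum_def
  proof (rule sum.cong[OF refl])
    fix r assume "r \<in> {..n}"
    then have "qpoch q q (Suc n - r) = qpoch q q (n - r) * (1 - q ^ (Suc n - r))"
      by (simp add: Suc_diff_le qpoch_Suc)
    moreover have "qpoch (a * q) q (Suc n + r) = qpoch (a * q) q (n + r) * (1 - a * q ^ (Suc n + r))"
      by (simp add: qpoch_Suc mult_ac)
    moreover have "1 - q ^ (Suc n - r) \<noteq> 0"
      using nz(2)[of "n - r"] \<open>r \<in> {..n}\<close> by (simp add: Suc_diff_le)
    ultimately show "(1 - q ^ (Suc n - r)) * (1 - a * q ^ (Suc n + r))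
            * (\<alpha> r / (qpoch q q (Suc n - r) * qpoch (a * q) q (Suc n + r)))
          = \<alpha> r / (qpoch q q (n - r) * qpoch (a * q) q (n + r))"
      using nz(1)[of "Suc n + r"] by simp
  qed
  finally have rec: "(1 - q ^ Suc n) * (1 + y * q ^ Suc n) * bailey_sum a q \<alpha> (Suc n)
      = bailey_sum a q \<alpha> n" .
  have "qpoch q q (Suc n) * bailey_sum a q \<alpha> (Suc n) * (1 + y * q ^ Suc n)
      = qpoch q q n * ((1 - q ^ Suc n) * (1 + y * q ^ Suc n) * bailey_sum a q \<alpha> (Suc n))"
    by (simp add: qpoch_Suc mult_ac)
  also have "\<dots> = 1 / qpoch (- (q * y)) q n"
    unfolding rec using Suc.IH by (simp add: a_def \<alpha>_def)
  finally have "qpoch q q (Suc n) * bailey_sum a q \<alpha> (Suc n)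
      = 1 / qpoch (- (q * y)) q n / (1 + y * q ^ Suc n)"
    using nz(3) by (metis nonzero_eq_divide_eq)
  moreover have "qpoch (- (q * y)) q (Suc n) = qpoch (- (q * y)) q n * (1 + y * q ^ Suc n)"
    by (simp add: qpoch_Suc mult_ac)
  ultimately show ?case
    by (simp add: a_def \<alpha>_def)
qed

text \<open>The factor \<open>q ^ (n choose 2)\<close> beats every exponential; with the crude bounds
  \<open>C ^ n\<close> for the other factors this settles all convergence questions inside the disk.\<close>

lemma summable_power_choose_2:
  fixes C r :: real
  assumes "0 \<le> r" "r < 1" "0 \<le> C"
  shows "summable (\<lambda>n. C ^ n * r ^ (n choose 2))"
proof -
  have "(\<lambda>n. C * r ^ n) \<longlonglongrightarrow> C * 0"
    using assms by (intro tendsto_mult tendsto_const LIMSEQ_realpow_zero)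
  then have "eventually (\<lambda>n. C * r ^ n < 1 / 2) sequentially"
    by (rule order_tendstoD) simp
  then obtain n0 where n0: "\<And>n. n \<ge> n0 \<Longrightarrow> C * r ^ n < 1 / 2"
    by (auto simp: eventually_sequentially)
  show ?thesis
  proof (rule summable_ratio_test[of "1 / 2" n0])
    fix n assume "n \<ge> n0"
    then have "C * r ^ n * (C ^ n * r ^ (n choose 2)) \<le> 1 / 2 * (C ^ n * r ^ (n choose 2))"
      using n0[of n] assms by (intro mult_right_mono) auto
    moreover have "(Suc n choose 2) = (n choose 2) + n"
      by (simp add: numeral_2_eq_2)
    ultimately show "norm (C ^ Suc n * r ^ (Suc n choose 2)) \<le> 1 / 2 * norm (C ^ n * r ^ (n choose 2))"
      using assms by (simp add: power_add mult_ac)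
  qed simp
qed

text \<open>The summable series 1-phi-1, a limiting case of the q-Gauss sum. For \<open>r = 0\<close> it telescopes.
  For the step, \<open>t'\<close> at \<open>r + 1\<close> minus \<open>1 - b q ^ (r + 1)\<close> times \<open>t\<close> at \<open>r\<close> telescopes as well.\<close>

lemma sums_q_gauss:
  assumes q: "norm q < 1" and b: "norm b < 1"
  shows "(\<lambda>k. gauss_binom q (r + k) k * ((-b) ^ k * q ^ (k choose 2) / qpoch (b * q ^ Suc r) q k))
           sums qpoch b q (Suc r)"
proof (induction r)
  case 0
  define u where "u k = (-b) ^ k * q ^ (k choose 2) * (1 - b) / qpoch b q k" for k
  have "u \<longlonglongrightarrow> 0"
  proof (rule Lim_null_comparison)
    show "(\<lambda>n. 2 * ((1 / (1 - norm b)) ^ n * norm q ^ (n choose 2))) \<longlonglongrightarrow> 0"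
      using tendsto_mult[OF tendsto_const summable_LIMSEQ_zero[OF summable_power_choose_2[of "norm q" "1 / (1 - norm b)"]]]
        q b by fastforce
    have "norm (u n) \<le> 2 * ((1 / (1 - norm b)) ^ n * norm q ^ (n choose 2))" for n
    proof -
      have 1: "(1 - norm b) ^ n \<le> norm (qpoch b q n)" "0 < (1 - norm b) ^ n"
        using norm_qpoch_ge[of b "norm b" q n] q b by auto
      have 2: "norm (1 - b) \<le> 2"
        using norm_triangle_ineq4[of 1 b] b by simp
      have 3: "norm ((- b) ^ n) \<le> 1"
        using b by (simp add: norm_power power_le_one)
      have "norm (u n) \<le> 1 * norm q ^ (n choose 2) * 2 / (1 - norm b) ^ n"
        unfolding u_def norm_divide norm_mult norm_power[of q]
        by (intro frac_le mult_mono 1 2 3) auto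
      then show ?thesis by (simp add: power_divide mult_ac)
    qed
    then show "eventually (\<lambda>n. norm (u n) \<le> 2 * ((1 / (1 - norm b)) ^ n * norm q ^ (n choose 2))) sequentially"
      by simp
  qed
  from telescope_sums'[OF this] have "(\<lambda>k. u k - u (Suc k)) sums (1 - b)"
    by (simp add: u_def numeral_2_eq_2)
  moreover have "u k - u (Suc k)
      = gauss_binom q (0 + k) k * ((-b) ^ k * q ^ (k choose 2) / qpoch (b * q ^ Suc 0) q k)" for k
  proof -
    have nz: "qpoch b q k \<noteq> 0" "1 - b * q ^ k \<noteq> 0" "1 - b \<noteq> 0"
      using qpoch_nonzero[OF b] one_minus_nonzero[OF b, of q k] one_minus_nonzero[OF b, of q 0] q by auto
    have ch: "(Suc k choose 2) = (k choose 2) + k"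
      by (simp add: numeral_2_eq_2)
    have "(1 - b) / (qpoch b q k * (1 - b * q ^ k)) = 1 / qpoch (b * q) q k"
      using qpoch_Suc_left[of b q k] nz(3) unfolding qpoch_Suc by simp
    moreover have "u k - u (Suc k)
        = (-b) ^ k * q ^ (k choose 2) * ((1 - b) / (qpoch b q k * (1 - b * q ^ k)))"
      unfolding u_def qpoch_Suc ch using nz by (simp add: divide_simps power_add) (simp add: algebra_simps)
    ultimately show ?thesis by simp
  qed
  ultimately show ?case
    by (simp add: qpoch_Suc)
next
  case (Suc r)
  define t where "t k = gauss_binom q (r + k) k
      * ((-b) ^ k * q ^ (k choose 2) / qpoch (b * q ^ Suc r) q k)" for k
  define t' where "t' k = gauss_binom q (Suc r + k) k
      * ((-b) ^ k * q ^ (k choose 2) / qpoch (b * q ^ Suc (Suc r)) q k)" for k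
  \<comment> \<open>The factor that makes \<open>G\<close> a telescoping certificate for the
    step from \<open>r\<close> to \<open>r + 1\<close>.\<close>
  define w where "w = q ^ Suc r * (1 - b * q ^ Suc r) / (1 - q ^ Suc r)"
  define G where "G k = w * (t k * (1 - q ^ k))" for k
  have br: "norm (b * q ^ j) < 1" for j
    using norm_mult_power_le[of q b j] q b by simp
  have nz: "qpoch (b * q ^ Suc r) q k \<noteq> 0" "qpoch (b * q ^ Suc (Suc r)) q k \<noteq> 0"
      "1 - b * q ^ k \<noteq> 0" "1 - q * q ^ k \<noteq> 0" "qpoch q q k \<noteq> 0" for k
    using qpoch_nonzero[OF br, of q "Suc r" k] qpoch_nonzero[OF br, of q "Suc (Suc r)" k]
      qpoch_nonzero[of q q] one_minus_nonzero[of b q] one_minus_nonzero[of q q] q b by simp_all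
  have t: "t sums qpoch b q (Suc r)"
    unfolding t_def by (rule Suc.IH)
  have "t' k = (1 - b * q ^ Suc r) * t k + (G k - G (Suc k))" for k
  proof -
    define X where "X = q ^ k"
    define g where "g = gauss_binom q (r + k) k"
    define P where "P = qpoch (b * q ^ Suc r) q k"
    define p where "p = q ^ Suc r"
    have p: "1 - p \<noteq> 0" "1 - b * p \<noteq> 0" "1 - b * p * X \<noteq> 0" "1 - q * X \<noteq> 0" "P \<noteq> 0"
      using nz(4)[of r] nz(3)[of "Suc r"] nz(3)[of "Suc r + k"] nz(4)[of k] nz(1)[of k]
      by (simp_all add: p_def X_def P_def power_add mult_ac)
    have g1: "gauss_binom q (Suc r + k) k = g * (1 - p * X) / (1 - p)"
      using nz(5) p(1) q by (simp add: g_def p_def X_def gauss_binom_eq qpoch_Suc power_add field_simps)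
    have g2: "gauss_binom q (r + Suc k) (Suc k) = g * (1 - p * X) / (1 - q * X)"
      using nz(5) p(4) q by (simp add: g_def p_def X_def gauss_binom_eq qpoch_Suc power_add field_simps)
    have P1: "qpoch (b * q ^ Suc r) q (Suc k) = P * (1 - b * p * X)"
      by (simp add: P_def p_def X_def qpoch_Suc)
    have P2: "qpoch (b * q ^ Suc (Suc r)) q k = P * (1 - b * p * X) / (1 - b * p)"
      using qpoch_Suc_left[of "b * q ^ Suc r" q k] p(2) unfolding P1
      by (simp add: field_simps p_def)
    define E where "E = (-b) ^ k * q ^ (k choose 2)"
    have E: "(-b) ^ Suc k * q ^ (Suc k choose 2) = - (b * X * E)"
      by (simp add: E_def X_def numeral_2_eq_2 power_add)
    have "t' k = g * E * ((1 - p * X) * (1 - b * p)) / ((1 - p) * (P * (1 - b * p * X)))"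
      unfolding t'_def g1 P2 E_def[symmetric] by (simp add: mult_ac)
    moreover have "t k = g * E / P"
      unfolding t_def g_def[symmetric] E_def[symmetric] P_def[symmetric] by simp
    moreover have "G k = p * (1 - b * p) * (1 - X) * (g * E) / ((1 - p) * P)"
      unfolding G_def t_def w_def by (simp add: g_def E_def P_def X_def p_def mult_ac)
    moreover have "G (Suc k) = - (p * (1 - b * p) * (b * X) * (1 - p * X) * (g * E)
        / ((1 - p) * (P * (1 - b * p * X))))"
      unfolding G_def t_def w_def g2 E P1 using p(4)
      by (simp add: X_def[symmetric] p_def[symmetric] del: power_Suc) (simp add: X_def mult_ac)
    moreover have "A * ((1 - p * X) * (1 - b * p)) / ((1 - p) * (P * (1 - b * p * X)))
        = (1 - b * p) * (A / P) + (p * (1 - b * p) * (1 - X) * A / ((1 - p) * P)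
           - - (p * (1 - b * p) * (b * X) * (1 - p * X) * A / ((1 - p) * (P * (1 - b * p * X)))))" for A
      using p by (simp add: divide_simps) algebra
    ultimately show ?thesis
      unfolding p_def[symmetric] by metis
  qed
  moreover have "(\<lambda>k. (1 - b * q ^ Suc r) * t k + (G k - G (Suc k)))
      sums ((1 - b * q ^ Suc r) * qpoch b q (Suc r) + (G 0 - 0))"
  proof (intro sums_add sums_mult t telescope_sums')
    have "t \<longlonglongrightarrow> 0"
      using t by (simp add: sums_iff summable_LIMSEQ_zero)
    moreover have "(\<lambda>k. q ^ k) \<longlonglongrightarrow> 0"
      using q by (rule LIMSEQ_power_zero)
    ultimately have "G \<longlonglongrightarrow> w * (0 * (1 - 0))"
      unfolding G_def by (intro tendsto_mult tendsto_diff tendsto_const)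
    then show "G \<longlonglongrightarrow> 0" by simp
  qed
  ultimately have "t' sums ((1 - b * q ^ Suc r) * qpoch b q (Suc r) + (G 0 - 0))"
    by presburger
  also have "(1 - b * q ^ Suc r) * qpoch b q (Suc r) + (G 0 - 0) = qpoch b q (Suc (Suc r))"
    by (simp add: G_def qpoch_Suc[of _ _ "Suc r"] mult.commute)
  finally show ?case
    unfolding t'_def .
qed

section \<open>A deformed false theta identity\<close>

text \<open>Iterating a lower triangular kernel. The definition is generic so that the same recursion describes
  the multisum itself, with complex entries, and its majorants, with real entries.\<close>

primrec kernel_chain ::
  "(nat \<Rightarrow> 'a) \<Rightarrow> (nat \<Rightarrow> nat \<Rightarrow> 'a) \<Rightarrow> nat \<Rightarrow> nat \<Rightarrow> 'a::comm_semiring_1" where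
  "kernel_chain c K 0 n = c n"
| "kernel_chain c K (Suc i) n = (\<Sum>j\<le>n. K n j * kernel_chain c K i j)"

text \<open>The deformed inner sums, as a function of the top index: \<open>i\<close> nested sums over the seed
  \<open>1 / (- q y)_n\<close>. For \<open>y = 1\<close> they are those of \<open>psi_term\<close>.\<close>

definition chain_beta :: "complex \<Rightarrow> complex \<Rightarrow> nat \<Rightarrow> nat \<Rightarrow> complex" where
  "chain_beta q y = kernel_chain (\<lambda>n. 1 / qpoch (- (q * y)) q n)
     (\<lambda>n j. gauss_binom q n j * ((q * y\<^sup>2) ^ j * q ^ j\<^sup>2))"

definition psi_summand :: "complex \<Rightarrow> complex \<Rightarrow> nat \<Rightarrow> nat \<Rightarrow> complex" where
  "psi_summand q y i n = (-1) ^ n * q ^ (Suc n choose 2) * y ^ (2 * n) * chain_beta q y i n"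

definition theta_exp :: "nat \<Rightarrow> nat \<Rightarrow> nat" where
  "theta_exp i r = Suc i * (r\<^sup>2 + r) + (r choose 2)"

definition theta_term :: "complex \<Rightarrow> complex \<Rightarrow> nat \<Rightarrow> nat \<Rightarrow> complex" where
  "theta_term q y i r = y ^ ((2 * i + 3) * r) * q ^ theta_exp i r * (1 - y\<^sup>2 * q ^ (2 * r + 1))"

lemma choose_2_add: "(r + k choose 2) = (r choose 2) + (k choose 2) + r * k"
  by (induction k) (simp_all add: numeral_2_eq_2)

lemma Suc_choose_2: "(Suc n choose 2) = (n choose 2) + n"
  by (simp add: numeral_2_eq_2)

lemma norm_kernel_chain_le:
  fixes c :: "nat \<Rightarrow> 'a::real_normed_field" and c' :: "nat \<Rightarrow> real"
  assumes "\<And>n. norm (c n) \<le> c' n" "\<And>n j. norm (K n j) \<le> K' n j"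
  shows "norm (kernel_chain c K i n) \<le> kernel_chain c' K' i n"
proof (induction i arbitrary: n)
  case (Suc i)
  have "0 \<le> K' n j" for j
    using assms(2) norm_ge_zero order_trans by blast
  then have "norm (\<Sum>j\<le>n. K n j * kernel_chain c K i j) \<le> (\<Sum>j\<le>n. K' n j * kernel_chain c' K' i j)"
    by (intro sum_norm_le) (auto simp: norm_mult intro!: mult_mono assms Suc.IH)
  then show ?case by simp
qed (use assms in simp)

text \<open>With binomial coefficients as the kernel the chain has a closed form, which bounds all chains
  whose kernel consists of Gaussian coefficients.\<close>

lemma kernel_chain_binomial:
  "kernel_chain (\<lambda>n. D ^ n) (\<lambda>n j. of_nat (n choose j)) i n = (D + of_nat i :: 'a::comm_semiring_1) ^ n"
proof (induction i arbitrary: n)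
  case (Suc i)
  show ?case
    using binomial_ring[of "D + of_nat i" 1 n] by (simp add: Suc.IH add_ac)
qed simp

lemma norm_chain_beta_kernel_le:
  fixes q y :: complex
  assumes "norm q \<le> 1" "norm y \<le> 1"
  shows "norm (gauss_binom q n j * ((q * y\<^sup>2) ^ j * q ^ j\<^sup>2)) \<le> of_nat (n choose j)"
proof -
  have le1: "norm ((q * y\<^sup>2) ^ j * q ^ j\<^sup>2) \<le> 1"
    using assms by (simp add: norm_mult norm_power power_le_one mult_le_one)
  show ?thesis
    using mult_mono[OF norm_gauss_binom_le[OF assms(1), of n j] le1] by (simp add: norm_mult)
qed

lemma norm_chain_beta_le:
  fixes q y :: complex
  assumes "norm q \<le> 1" "norm y \<le> 1" "norm (q * y) < 1"
  shows "norm (chain_beta q y i n) \<le> (1 / (1 - norm (q * y)) + of_nat i) ^ n"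
proof -
  have "norm (1 / qpoch (- (q * y)) q n) \<le> (1 / (1 - norm (q * y))) ^ n" for n
    using assms by (intro norm_inverse_qpoch_le) auto
  then have "norm (chain_beta q y i n)
      \<le> kernel_chain (\<lambda>n. (1 / (1 - norm (q * y))) ^ n) (\<lambda>n j. of_nat (n choose j)) i n"
    unfolding chain_beta_def using norm_chain_beta_kernel_le[OF assms(1,2)]
    by (intro norm_kernel_chain_le) auto
  then show ?thesis
    by (simp add: kernel_chain_binomial)
qed

lemma chain_beta_bailey:
  assumes "norm q < 1" "norm y \<le> 1"
  shows "chain_beta q y i n = qpoch q q n
     * bailey_sum (q * y\<^sup>2) q (\<lambda>r. ((q * y\<^sup>2) ^ r * q ^ r\<^sup>2) ^ i * seed_alpha q y r) n"
proof (induction i arbitrary: n)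
  case 0
  show ?case
    using bailey_seed[OF assms] by (simp add: chain_beta_def)
next
  case (Suc i)
  have "chain_beta q y (Suc i) n
      = (\<Sum>j\<le>n. gauss_binom q n j * ((q * y\<^sup>2) ^ j * q ^ j\<^sup>2) * chain_beta q y i j)"
    by (simp add: chain_beta_def)
  then show ?case
    unfolding Suc.IH using bailey_step[OF assms(1) less_imp_le[OF norm_q_y2(1)[OF assms]]]
    by (simp add: mult_ac)
qed

text \<open>The contribution of one \<open>\<alpha> r\<close> to the alternating sum of a Bailey pair. This is the Bailey lemma
  with one parameter equal to \<open>q\<close> and the other tending to infinity, at the level of the column
  \<open>r\<close> of the Bailey matrix.\<close>

lemma sums_bailey_column:
  fixes a q :: complex
  assumes q: "norm q < 1" and a: "norm a < 1"
  shows "(\<lambda>n. if r \<le> n then (-1) ^ n * q ^ (n choose 2) * a ^ n * qpoch q q n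
            / (qpoch q q (n - r) * qpoch (a * q) q (n + r)) else 0)
         sums ((-1) ^ r * q ^ (r choose 2) * a ^ r * qpoch q q r * (1 - a) / qpoch a q r)"
    (is "?f sums ?s")
proof -
  define b where "b = a * q ^ r"
  have b: "norm b < 1"
    using norm_mult_power_le[of q a r] q a by (simp add: b_def)
  have nz: "qpoch (a * q) q j \<noteq> 0" "qpoch a q j \<noteq> 0" "1 - a \<noteq> 0" "qpoch q q j \<noteq> 0"
      "qpoch b q j \<noteq> 0" for j
    using qpoch_nonzero[of "a * q" q] norm_mult_power_le[of q a 1] qpoch_nonzero[of a q]
      qpoch_nonzero[of q q] qpoch_nonzero[of b q] b q a by auto
  have shift: "?f (k + r) = (-1) ^ r * q ^ (r choose 2) * a ^ r * qpoch q q r / qpoch (a * q) q (2 * r)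
      * (gauss_binom q (r + k) k * ((-b) ^ k * q ^ (k choose 2) / qpoch (b * q ^ Suc r) q k))" for k
  proof -
    have "k + r + r = 2 * r + k"
      by simp
    then have "qpoch (a * q) q (k + r + r) = qpoch (a * q) q (2 * r + k)"
      by (rule arg_cong)
    also have "\<dots> = qpoch (a * q) q (2 * r) * qpoch (b * q ^ Suc r) q k"
      by (subst qpoch_add) (simp add: b_def mult_ac mult_2_right power_add)
    finally have "qpoch (a * q) q (k + r + r) = qpoch (a * q) q (2 * r) * qpoch (b * q ^ Suc r) q k" .
    moreover have "gauss_binom q (r + k) k = qpoch q q (k + r) / (qpoch q q r * qpoch q q k)"
      using q by (simp add: gauss_binom_eq add.commute)
    moreover have "(-1) ^ (k + r) * q ^ (k + r choose 2) * a ^ (k + r)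
        = (-1) ^ r * q ^ (r choose 2) * a ^ r * ((-b) ^ k * q ^ (k choose 2))"
    proof -
      have "(-b) ^ k = (-1) ^ k * (a ^ k * q ^ (r * k))"
        by (simp add: b_def power_minus[of "a * q ^ r"] power_mult_distrib power_mult)
      then show ?thesis
        by (simp add: choose_2_add power_add mult_ac)
    qed
    ultimately show ?thesis
      using nz(4)[of r] by simp (simp add: mult_ac)
  qed
  have "(\<lambda>k. ?f (k + r)) sums ((-1) ^ r * q ^ (r choose 2) * a ^ r * qpoch q q r
      / qpoch (a * q) q (2 * r) * qpoch b q (Suc r))"
    unfolding shift by (intro sums_mult sums_q_gauss q b)
  also have "qpoch (a * q) q (2 * r) * (1 - a) = qpoch a q r * qpoch b q (Suc r)"
  proof -
    have "Suc (2 * r) = r + Suc r"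
      by simp
    then show ?thesis
      unfolding b_def by (metis mult.commute qpoch_add qpoch_Suc_left)
  qed
  then have "qpoch b q (Suc r) / qpoch (a * q) q (2 * r) = (1 - a) / qpoch a q r"
    using nz by (simp add: divide_simps mult_ac)
  then have "(-1) ^ r * q ^ (r choose 2) * a ^ r * qpoch q q r / qpoch (a * q) q (2 * r) * qpoch b q (Suc r)
      = ?s"
    by (metis (no_types, lifting) times_divide_eq_left times_divide_eq_right)
  finally have "(\<lambda>k. ?f (k + r)) sums ?s" .
  moreover have "(\<Sum>n<r. ?f n) = 0"
    by (intro sum.neutral) auto
  ultimately show ?thesis
    using sums_iff_shift[of ?f r ?s] by simp
qed

text \<open>Insert the Bailey pair into the summand, which gives a double series over \<open>r \<le> n\<close>. Summing it by
  rows returns the left-hand side, and summing it by columns the right-hand side.\<close>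

lemma false_theta_identity:
  assumes q: "norm q < 1" and y: "norm y \<le> 1"
  shows "(\<Sum>n. psi_summand q y i n) = (\<Sum>r. theta_term q y i r)"
proof -
  define a where "a = q * y\<^sup>2"
  define \<alpha> where "\<alpha> r = (a ^ r * q ^ r\<^sup>2) ^ i * seed_alpha q y r" for r
  define Q where "Q = 1 / (1 - norm q)"
  define c where "c n r = (if r \<le> n then (-1) ^ n * q ^ (n choose 2) * a ^ n * qpoch q q n
            / (qpoch q q (n - r) * qpoch (a * q) q (n + r)) else 0)" for n r
  \<comment> \<open>A majorant of the double series: a summable sequence in \<open>n\<close> times
    \<open>(1 / 2) ^ r\<close>, where the geometric factor is affordable since \<open>r \<le> n\<close>.\<close>
  define M where "M n = 2 * Q * ((16 * Q ^ 4) ^ n * norm q ^ (n choose 2))" for n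
  have a: "norm a < 1" "norm (a * q) \<le> norm q" "norm a \<le> norm q"
    using norm_q_y2[OF q y] y
    by (auto simp: a_def norm_mult norm_power mult_left_le power_le_one mult_le_one
        intro!: mult_left_le_one_le)
  have Q: "1 \<le> Q"
    using q by (simp add: Q_def)
  have inv_qpoch: "norm (1 / qpoch x q n) \<le> Q ^ n" if "norm x \<le> norm q" for x n
    using norm_inverse_qpoch_le[OF that q] q by (simp add: Q_def)
  have \<alpha>_le: "norm (\<alpha> r) \<le> 2 * Q * (2 * Q) ^ r" for r
  proof -
    have 1: "norm ((a ^ r * q ^ r\<^sup>2) ^ i) \<le> 1" "norm ((- y) ^ r * q ^ r\<^sup>2) \<le> 1"
      using a q y by (simp_all add: norm_mult norm_power power_le_one mult_le_one)
    have 2: "norm (1 - a * q ^ (2 * r)) \<le> 2"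
      using norm_triangle_ineq4[of 1 "a * q ^ (2 * r)"] norm_mult_power_le[of q a "2 * r"] a q by simp
    have 3: "norm (1 / (1 - a)) \<le> Q"
      using inv_qpoch[of a 1] a by (simp add: qpoch_Suc)
    have "norm (\<alpha> r) = norm ((a ^ r * q ^ r\<^sup>2) ^ i) * (norm (1 - a * q ^ (2 * r)) * norm (1 / (1 - a))
        * (norm (qpoch a q r) * norm (1 / qpoch q q r)) * norm ((- y) ^ r * q ^ r\<^sup>2))"
      by (simp add: \<alpha>_def seed_alpha_def a_def[symmetric] norm_mult norm_divide)
    also have "\<dots> \<le> 1 * (2 * Q * (2 ^ r * Q ^ r) * 1)"
      using a q Q by (intro mult_mono 1 2 3 norm_qpoch_le inv_qpoch mult_nonneg_nonneg) auto
    finally show ?thesis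
      by (simp add: power_mult_distrib)
  qed
  have c_le: "norm (c n r * \<alpha> r) \<le> M n * (1 / 2) ^ r" for n r
  proof (cases "r \<le> n")
    case True
    have "norm (c n r) = 1 * norm q ^ (n choose 2) * norm a ^ n * norm (qpoch q q n)
        * (norm (1 / qpoch q q (n - r)) * norm (1 / qpoch (a * q) q (n + r)))"
      using True by (simp add: c_def norm_mult norm_divide norm_power)
    also have "\<dots> \<le> 1 * norm q ^ (n choose 2) * 1 * 2 ^ n * (Q ^ n * Q ^ (2 * n))"
    proof (intro mult_mono norm_qpoch_le order_refl)
      show "norm (1 / qpoch q q (n - r)) \<le> Q ^ n"
        using inv_qpoch[of q "n - r"] power_increasing[OF _ Q, of "n - r" n] by simp
      show "norm (1 / qpoch (a * q) q (n + r)) \<le> Q ^ (2 * n)"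
        using inv_qpoch[of "a * q" "n + r"] a power_increasing[OF _ Q, of "n + r" "2 * n"] True by simp
    qed (use a q Q in \<open>auto simp: power_le_one\<close>)
    finally have "norm (c n r) * norm (\<alpha> r)
        \<le> (norm q ^ (n choose 2) * 2 ^ n * (Q ^ n * Q ^ (2 * n))) * (2 * Q * (2 * Q) ^ r)"
      using \<alpha>_le[of r] Q by (intro mult_mono) auto
    also have "(2 * Q) ^ r = (4 * Q) ^ r * (1 / 2) ^ r"
      by (subst power_mult_distrib[symmetric]) simp
    also have "(norm q ^ (n choose 2) * 2 ^ n * (Q ^ n * Q ^ (2 * n))) * (2 * Q * ((4 * Q) ^ r * (1 / 2) ^ r))
        \<le> (norm q ^ (n choose 2) * 2 ^ n * (Q ^ n * Q ^ (2 * n))) * (2 * Q * ((4 * Q) ^ n * (1 / 2) ^ r))"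
      using True Q by (intro mult_left_mono mult_right_mono power_increasing) auto
    also have "\<dots> = 2 * Q * ((8 * Q ^ 4) ^ n * norm q ^ (n choose 2)) * (1 / 2) ^ r"
    proof -
      have "(8 * Q ^ 4) ^ n = 2 ^ n * (Q ^ n * Q ^ (2 * n)) * (4 * Q) ^ n"
      proof -
        have "8 * Q ^ 4 = 2 * (Q * Q\<^sup>2) * (4 * Q)"
          by (simp add: power4_eq_xxxx power2_eq_square)
        then show ?thesis
          by (simp only: power_mult_distrib power_mult)
      qed
      then show ?thesis by simp
    qed
    also have "\<dots> \<le> M n * (1 / 2) ^ r"
      unfolding M_def using Q
      by (intro mult_right_mono mult_left_mono power_mono) auto
    finally show ?thesis by (simp add: norm_mult)
  qed (use Q in \<open>simp add: c_def M_def\<close>)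
  have M: "summable M"
    unfolding M_def using q Q by (intro summable_mult summable_power_choose_2) auto
  have M0: "0 \<le> M n" for n
    using Q by (simp add: M_def)
  define g where "g = (\<lambda>(n, r). M n * (1 / 2) ^ r)"
  have half: "((\<lambda>r. (1 / 2 :: real) ^ r) has_sum 2) UNIV"
    using norm_summable_imp_has_sum[of "\<lambda>r. (1 / 2) ^ r :: real" 2] geometric_sums[of "1 / 2 :: real"]
    by (simp add: norm_power)
  have "g summable_on UNIV \<times> UNIV"
  proof (rule summable_on_SigmaI)
    show "((\<lambda>r. g (n, r)) has_sum (M n * 2)) UNIV" for n
      unfolding g_def by (simp add: has_sum_cmult_right[OF half, of "M n"])
    show "(\<lambda>n. M n * 2) summable_on UNIV"
      using M M0 by (intro summable_nonneg_imp_summable_on summable_mult2) auto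
    show "0 \<le> g (n, r)" for n r
      using M0 by (simp add: g_def)
  qed
  then have ns: "(\<lambda>z. norm (case z of (n, r) \<Rightarrow> c n r * \<alpha> r)) summable_on UNIV \<times> UNIV"
    by (rule Infinite_Sum.abs_summable_on_comparison_test') (use c_le in \<open>auto simp: g_def\<close>)
  then obtain S where S: "((\<lambda>(n, r). c n r * \<alpha> r) has_sum S) (UNIV \<times> UNIV)"
    using abs_summable_summable summable_on_def by blast
  have row: "((\<lambda>r. c n r * \<alpha> r) has_sum psi_summand q y i n) UNIV" for n
  proof -
    have "psi_summand q y i n = (\<Sum>r\<le>n. c n r * \<alpha> r)"
    proof -
      have e: "q ^ (Suc n choose 2) * y ^ (2 * n) = q ^ (n choose 2) * a ^ n"
        by (simp add: Suc_choose_2 a_def power_add power_mult_distrib power_mult)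
      have "psi_summand q y i n = (-1) ^ n * (q ^ (Suc n choose 2) * y ^ (2 * n)) * chain_beta q y i n"
        by (simp add: psi_summand_def)
      also have "\<dots> = (-1) ^ n * (q ^ (n choose 2) * a ^ n) * (qpoch q q n * bailey_sum a q \<alpha> n)"
        unfolding e chain_beta_bailey[OF q y] \<alpha>_def[abs_def] a_def ..
      also have "\<dots> = (\<Sum>r\<le>n. c n r * \<alpha> r)"
        by (simp add: bailey_sum_def c_def sum_distrib_left mult_ac)
      finally show ?thesis .
    qed
    then show ?thesis
      by (intro has_sum_finite_neutralI[of "{..n}"]) (auto simp: c_def)
  qed
  have column: "((\<lambda>n. c n r * \<alpha> r) has_sum theta_term q y i r) UNIV" for r
  proof (rule norm_summable_imp_has_sum)
    show "summable (\<lambda>n. norm (c n r * \<alpha> r))"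
      by (rule summable_comparison_test'[OF summable_mult2[OF M, of "(1 / 2) ^ r"]]) (use c_le in simp)
    have nz: "qpoch a q r \<noteq> 0" "1 - a \<noteq> 0" "qpoch q q r \<noteq> 0"
      using qpoch_nonzero[of a q r] qpoch_nonzero[of q q r] a q by auto
    have "(-1) ^ r * q ^ (r choose 2) * a ^ r * qpoch q q r * (1 - a) / qpoch a q r * \<alpha> r
        = (-1) ^ r * q ^ (r choose 2) * a ^ r * (a ^ r * q ^ r\<^sup>2) ^ i
          * (1 - a * q ^ (2 * r)) * ((-y) ^ r * q ^ r\<^sup>2)"
      unfolding \<alpha>_def seed_alpha_def a_def[symmetric] using nz by simp
    also have "\<dots> = theta_term q y i r"
    proof -
      have "(a ^ r * q ^ r\<^sup>2) = y ^ (2 * r) * q ^ (r\<^sup>2 + r)"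
        by (simp add: a_def power_mult_distrib power_mult power_add)
      then have "(a ^ r * q ^ r\<^sup>2) ^ i = y ^ (2 * r * i) * q ^ (i * (r\<^sup>2 + r))"
        by (simp add: power_mult_distrib power_mult[symmetric] mult_ac)
      moreover have "a ^ r = y ^ (2 * r) * q ^ r"
        by (simp add: a_def power_mult_distrib power_mult)
      moreover have "(-1) ^ r * (-y) ^ r = y ^ r"
        by (simp add: power_mult_distrib[symmetric])
      moreover have "y ^ ((2 * i + 3) * r) = y ^ r * y ^ (2 * r) * y ^ (2 * r * i)"
        by (simp add: power_add[symmetric] algebra_simps)
      moreover have "q ^ theta_exp i r = q ^ (r choose 2) * q ^ r * q ^ r\<^sup>2 * q ^ (i * (r\<^sup>2 + r))"
        by (simp add: theta_exp_def power_add[symmetric] algebra_simps)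
      ultimately show ?thesis
        by (simp add: theta_term_def a_def mult_ac)
    qed
    finally show "(\<lambda>n. c n r * \<alpha> r) sums theta_term q y i r"
      using sums_mult2[OF sums_bailey_column[OF q a(1), of r], of "\<alpha> r"] by (simp only: c_def)
  qed
  have "(psi_summand q y i has_sum S) UNIV"
    by (rule has_sum_SigmaD[OF S]) (use row in auto)
  moreover have "((\<lambda>(r, n). c n r * \<alpha> r) has_sum S) (UNIV \<times> UNIV)"
    using has_sum_swap[THEN iffD1, OF S] by (simp add: case_prod_beta)
  then have "(theta_term q y i has_sum S) UNIV"
    by (rule has_sum_SigmaD) (use column in auto)
  ultimately show ?thesis
    by (metis has_sum_imp_sums sums_unique)
qed

section \<open>Multisums over tuples as iterated sums\<close>

lemma sum_PiE_insert:
  assumes "x \<notin> S"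
  shows "(\<Sum>f\<in>insert x S \<rightarrow>\<^sub>E A. g f) = (\<Sum>y\<in>A. \<Sum>f\<in>S \<rightarrow>\<^sub>E A. g (f(x := y)))"
proof -
  have "(\<Sum>f\<in>insert x S \<rightarrow>\<^sub>E A. g f) = (\<Sum>z\<in>A \<times> (S \<rightarrow>\<^sub>E A). g ((\<lambda>(y, f). f(x := y)) z))"
    unfolding PiE_insert_eq by (rule sum.reindex[OF inj_combinator[OF assms], unfolded comp_def])
  also have "\<dots> = (\<Sum>y\<in>A. \<Sum>f\<in>S \<rightarrow>\<^sub>E A. g (f(x := y)))"
    by (simp add: sum.cartesian_product case_prod_beta)
  finally show ?thesis .
qed

text \<open>The contribution of a single tuple to a kernel chain; the coordinates of the tuple are read from
  the innermost, \<open>f 1\<close>, to the top one, \<open>f (i + 1)\<close>.\<close>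

definition chain_weight :: "(nat \<Rightarrow> 'a) \<Rightarrow> (nat \<Rightarrow> nat \<Rightarrow> 'a) \<Rightarrow> nat \<Rightarrow> (nat \<Rightarrow> nat) \<Rightarrow> 'a::comm_semiring_1" where
  "chain_weight c K i f = c (f 1) * (\<Prod>t=1..i. K (f (Suc t)) (f t))"

text \<open>Peel off the top coordinate of the tuple. Since the kernel is lower triangular, the common bound
  \<open>L\<close> of the coordinates may be replaced by the bound \<open>f (t + 1)\<close> on \<open>f t\<close>. The induction
  absorbs the kernel into the weight \<open>h\<close>, which must therefore be arbitrary.\<close>

lemma sum_chain_weight:
  fixes h c :: "nat \<Rightarrow> 'a::comm_semiring_1"
  assumes K: "\<And>n j. n < j \<Longrightarrow> K n j = 0"
  shows "(\<Sum>f\<in>{1..Suc i} \<rightarrow>\<^sub>E {..<L}. h (f (Suc i)) * chain_weight c K i f)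
       = (\<Sum>n<L. h n * kernel_chain c K i n)"
proof (induction i arbitrary: h)
  case 0
  have "{1..Suc 0} = insert 1 {}" by auto
  then show ?case
    using sum_PiE_insert[of 1 "{}" "\<lambda>f. h (f (Suc 0)) * chain_weight c K 0 f" "{..<L}"]
    by (simp add: chain_weight_def)
next
  case (Suc i)
  have ins: "{1..Suc (Suc i)} = insert (Suc (Suc i)) {1..Suc i}" by auto
  have upd: "chain_weight c K (Suc i) (f(Suc (Suc i) := n)) = K n (f (Suc i)) * chain_weight c K i f"
    for f n
    by (simp add: chain_weight_def mult_ac)
  have "(\<Sum>f\<in>{1..Suc (Suc i)} \<rightarrow>\<^sub>E {..<L}. h (f (Suc (Suc i))) * chain_weight c K (Suc i) f)
      = (\<Sum>n<L. \<Sum>f\<in>{1..Suc i} \<rightarrow>\<^sub>E {..<L}. h n * (K n (f (Suc i)) * chain_weight c K i f))"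
    unfolding ins by (subst sum_PiE_insert) (simp_all add: upd)
  also have "\<dots> = (\<Sum>n<L. h n * (\<Sum>j<L. K n j * kernel_chain c K i j))"
    by (simp only: sum_distrib_left[symmetric] Suc.IH)
  also have "\<dots> = (\<Sum>n<L. h n * kernel_chain c K (Suc i) n)"
  proof (intro sum.cong refl arg_cong[where f = "(*) _"])
    fix n assume "n \<in> {..<L}"
    then have "(\<Sum>j<L. K n j * kernel_chain c K i j) = (\<Sum>j\<le>n. K n j * kernel_chain c K i j)"
      by (intro sum.mono_neutral_right) (auto simp: K)
    then show "(\<Sum>j<L. K n j * kernel_chain c K i j) = kernel_chain c K (Suc i) n"
      by simp
  qed
  finally show ?case .
qed

lemma finite_subset_PiE_lessThan:
  fixes F :: "('a \<Rightarrow> nat) set"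
  assumes "finite F" "finite I" "F \<subseteq> I \<rightarrow>\<^sub>E UNIV"
  obtains L0 where "\<And>L. L \<ge> L0 \<Longrightarrow> F \<subseteq> I \<rightarrow>\<^sub>E {..<L}"
proof -
  have "finite (\<Union>f\<in>F. f ` I)"
    using assms by auto
  then obtain L0 where "\<forall>x\<in>(\<Union>f\<in>F. f ` I). x < L0"
    by (meson finite_nat_set_iff_bounded)
  then have "f t < L" if "f \<in> F" "t \<in> I" "L \<ge> L0" for f t L
    using that by (meson UN_I image_eqI less_le_trans)
  then have "F \<subseteq> I \<rightarrow>\<^sub>E {..<L}" if "L \<ge> L0" for L
    using assms(3) that by (auto simp: PiE_iff)
  then show ?thesis by (rule that)
qed

text \<open>The boxes \<open>{..<L}\<close> exhaust the set of all tuples. Applied to the norms, the finite identity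
  bounds all finite partial sums, so that the unordered sum exists; applied to the terms
  themselves, it then identifies the value.\<close>

lemma infsum_chain_weight:
  fixes h c :: "nat \<Rightarrow> 'a::{real_normed_field, banach}"
  assumes K: "\<And>n j. n < j \<Longrightarrow> K n j = 0"
  assumes s: "summable (\<lambda>n. norm (h n) * kernel_chain (\<lambda>n. norm (c n)) (\<lambda>n j. norm (K n j)) i n)"
  shows "(\<Sum>\<^sub>\<infinity>f\<in>{1..Suc i} \<rightarrow>\<^sub>E UNIV. h (f (Suc i)) * chain_weight c K i f)
       = (\<Sum>n. h n * kernel_chain c K i n)"
proof -
  define A where "A = {1..Suc i} \<rightarrow>\<^sub>E (UNIV :: nat set)"
  define g where "g f = h (f (Suc i)) * chain_weight c K i f" for f
  define g' where "g' n = norm (h n) * kernel_chain (\<lambda>n. norm (c n)) (\<lambda>n j. norm (K n j)) i n" for n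
  have g': "norm (h n * kernel_chain c K i n) \<le> g' n" for n
    unfolding g'_def norm_mult by (intro mult_left_mono norm_kernel_chain_le) auto
  then have g'0: "0 \<le> g' n" for n
    using norm_ge_zero order_trans by blast
  have ng: "norm (g f) = norm (h (f (Suc i))) * chain_weight (\<lambda>n. norm (c n)) (\<lambda>n j. norm (K n j)) i f" for f
    by (simp add: g_def chain_weight_def norm_mult prod_norm)
  have "(\<Sum>f\<in>F. norm (g f)) \<le> suminf g'" if F: "F \<subseteq> A" "finite F" for F
  proof -
    obtain L where "\<And>L'. L' \<ge> L \<Longrightarrow> F \<subseteq> {1..Suc i} \<rightarrow>\<^sub>E {..<L'}"
      using finite_subset_PiE_lessThan[OF F(2) finite_atLeastAtMost, of 1 "Suc i"] F(1)
      unfolding A_def by blast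
    then have L: "F \<subseteq> {1..Suc i} \<rightarrow>\<^sub>E {..<L}"
      by simp
    have "(\<Sum>f\<in>F. norm (g f)) \<le> (\<Sum>f\<in>{1..Suc i} \<rightarrow>\<^sub>E {..<L}. norm (g f))"
      using L by (intro sum_mono2) (auto intro!: finite_PiE)
    also have "\<dots> = (\<Sum>n<L. g' n)"
      unfolding ng g'_def using K by (intro sum_chain_weight) simp
    also have "\<dots> \<le> suminf g'"
      using s g'0 unfolding g'_def[symmetric] by (intro sum_le_suminf) (auto simp: g'_def)
    finally show ?thesis .
  qed
  then have "(\<lambda>f. norm (g f)) summable_on A"
    by (intro nonneg_bdd_above_summable_on bdd_aboveI[of _ "suminf g'"]) auto
  from has_sum_infsum[OF abs_summable_summable[OF this]]
  have "(sum g \<longlongrightarrow> infsum g A) (finite_subsets_at_top A)"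
    by (simp add: has_sum_def)
  moreover have "filterlim (\<lambda>L. {1..Suc i} \<rightarrow>\<^sub>E {..<L}) (finite_subsets_at_top A) sequentially"
    unfolding filterlim_finite_subsets_at_top
  proof (intro allI impI)
    fix X assume X: "finite X \<and> X \<subseteq> A"
    then obtain L0 where "\<And>L. L \<ge> L0 \<Longrightarrow> X \<subseteq> {1..Suc i} \<rightarrow>\<^sub>E {..<L}"
      using finite_subset_PiE_lessThan[OF _ finite_atLeastAtMost, of X 1 "Suc i"] unfolding A_def by blast
    then show "\<forall>\<^sub>F L in sequentially. finite ({1..Suc i} \<rightarrow>\<^sub>E {..<L}) \<and>
        X \<subseteq> {1..Suc i} \<rightarrow>\<^sub>E {..<L} \<and> {1..Suc i} \<rightarrow>\<^sub>E {..<L} \<subseteq> A"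
      unfolding eventually_sequentially A_def
      by (intro exI[of _ L0]) (auto intro!: finite_PiE)
  qed
  ultimately have "(\<lambda>L. sum g ({1..Suc i} \<rightarrow>\<^sub>E {..<L})) \<longlonglongrightarrow> infsum g A"
    by (rule filterlim_compose)
  moreover have "sum g ({1..Suc i} \<rightarrow>\<^sub>E {..<L}) = (\<Sum>n<L. h n * kernel_chain c K i n)" for L
    unfolding g_def by (rule sum_chain_weight) (rule K)
  ultimately have "(\<lambda>n. h n * kernel_chain c K i n) sums infsum g A"
    by (simp add: sums_def)
  then show ?thesis
    unfolding A_def g_def[abs_def] by (rule sums_unique)
qed

lemma psi_term_eq_chain_weight:
  "psi_term (i + 2) q f = (-1) ^ f (Suc i) * q ^ (Suc (f (Suc i)) choose 2)
     * chain_weight (\<lambda>n. 1 / qpoch (- (q * 1)) q n)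
         (\<lambda>n j. gauss_binom q n j * ((q * 1\<^sup>2) ^ j * q ^ j\<^sup>2)) i f"
proof -
  \<comment> \<open>The literal \<open>1\<close> is the value of the parameter \<open>y\<close>, kept unsimplified to match
    the deformed kernel.\<close>
  have e: "(q * 1\<^sup>2) ^ j * q ^ j\<^sup>2 = q ^ (j\<^sup>2 + j)" for j
    by (simp add: power_add)
  have "q ^ ((f (Suc i) + 1 choose 2) + (\<Sum>t=1..i. (f t)\<^sup>2 + f t))
      = q ^ (Suc (f (Suc i)) choose 2) * (\<Prod>t=1..i. q ^ ((f t)\<^sup>2 + f t))"
    by (simp only: power_add[of q "_ choose 2"] power_sum Suc_eq_plus1)
  moreover have "psi_term (i + 2) q f
      = (-1) ^ f (Suc i) * q ^ ((f (Suc i) + 1 choose 2) + (\<Sum>t=1..i. (f t)\<^sup>2 + f t))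
        / qpoch (- q) q (f 1) * (\<Prod>t=1..i. gauss_binom q (f (Suc t)) (f t))"
    by (simp add: psi_term_def gauss_binom_def)
  moreover have "chain_weight (\<lambda>n. 1 / qpoch (- (q * 1)) q n)
         (\<lambda>n j. gauss_binom q n j * ((q * 1\<^sup>2) ^ j * q ^ j\<^sup>2)) i f
      = 1 / qpoch (- q) q (f 1) * ((\<Prod>t=1..i. gauss_binom q (f (Suc t)) (f t))
        * (\<Prod>t=1..i. q ^ ((f t)\<^sup>2 + f t)))"
    unfolding chain_weight_def e prod.distrib by simp
  ultimately show ?thesis
    by (simp only: times_divide_eq_left times_divide_eq_right mult_1 mult_ac)
qed

lemma Z_eq_sum_psi_summand: "Z (i + 2) N q = (\<Sum>n<N. psi_summand q 1 i n)"
proof -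
  have "Z (i + 2) N q = (\<Sum>f\<in>{1..Suc i} \<rightarrow>\<^sub>E {..<N}. psi_term (i + 2) q f)"
    by (simp add: Z_def atLeast0LessThan)
  also have "\<dots> = (\<Sum>n<N. (-1) ^ n * q ^ (Suc n choose 2) * chain_beta q 1 i n)"
    unfolding psi_term_eq_chain_weight chain_beta_def
    by (rule sum_chain_weight[where h = "\<lambda>n. (-1) ^ n * q ^ (Suc n choose 2)"
        and c = "\<lambda>n. 1 / qpoch (- (q * 1)) q n"
        and K = "\<lambda>n j. gauss_binom q n j * ((q * 1\<^sup>2) ^ j * q ^ j\<^sup>2)"]) simp
  also have "\<dots> = (\<Sum>n<N. psi_summand q 1 i n)"
    unfolding psi_summand_def power_one mult_1_right ..
  finally show ?thesis .
qed

lemma infsum_psi_term: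
  assumes q: "norm q < 1"
  shows "(\<Sum>\<^sub>\<infinity>f\<in>{1..Suc i} \<rightarrow>\<^sub>E UNIV. psi_term (i + 2) q f) = (\<Sum>n. psi_summand q 1 i n)"
proof -
  define D where "D = 1 / (1 - norm q)"
  have D: "norm (1 / qpoch (- (q * 1)) q n) \<le> D ^ n" for n
    using norm_inverse_qpoch_le[of "- q" "norm q" q n] q by (simp add: D_def)
  have D0: "0 \<le> D"
    using q by (simp add: D_def)
  have "norm (norm ((-1) ^ n * q ^ (Suc n choose 2)) * kernel_chain (\<lambda>n. norm (1 / qpoch (- (q * 1)) q n))
      (\<lambda>n j. norm (gauss_binom q n j * ((q * 1\<^sup>2) ^ j * q ^ j\<^sup>2))) i n)
     \<le> (D + real i) ^ n * norm q ^ (n choose 2)" for n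
  proof -
    have 1: "norm (kernel_chain (\<lambda>n. norm (1 / qpoch (- (q * 1)) q n))
      (\<lambda>n j. norm (gauss_binom q n j * ((q * 1\<^sup>2) ^ j * q ^ j\<^sup>2))) i n)
      \<le> kernel_chain (\<lambda>n. D ^ n) (\<lambda>n j. of_nat (n choose j)) i n"
      using D norm_chain_beta_kernel_le[of q 1] q by (intro norm_kernel_chain_le) simp_all
    have 2: "norm ((-1) ^ n * q ^ (Suc n choose 2)) \<le> norm q ^ (n choose 2)"
      using q by (auto simp: norm_mult norm_power Suc_choose_2 intro!: power_decreasing)
    show ?thesis
      unfolding norm_mult[of "norm ((-1) ^ n * q ^ (Suc n choose 2))"] real_norm_def[of "norm _"]
        abs_norm_cancel mult.commute[of _ "norm q ^ (n choose 2)"] kernel_chain_binomial[symmetric]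
      by (intro mult_mono 2) (use 1 in auto)
  qed
  then have "summable (\<lambda>n. norm ((-1) ^ n * q ^ (Suc n choose 2)) * kernel_chain (\<lambda>n. norm (1 / qpoch (- (q * 1)) q n))
      (\<lambda>n j. norm (gauss_binom q n j * ((q * 1\<^sup>2) ^ j * q ^ j\<^sup>2))) i n)"
    using q D0 by (intro summable_comparison_test'[OF summable_power_choose_2[of "norm q" "D + real i"]]) auto
  then show ?thesis
    unfolding psi_term_eq_chain_weight
    by (subst infsum_chain_weight[where h = "\<lambda>n. (-1) ^ n * q ^ (Suc n choose 2)"])
       (simp_all add: psi_summand_def[abs_def] chain_beta_def)
qed

section \<open>Roots of unity of odd order\<close>

locale odd_root_of_unity =
  fixes z :: complex and N :: nat
  assumes odd_N: "odd N"
    and root: "z ^ N = 1"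
    and primitive: "\<And>j. 0 < j \<Longrightarrow> j < N \<Longrightarrow> z ^ j \<noteq> 1"
begin

lemma N_pos: "0 < N"
  using odd_N by (rule odd_pos)

lemma norm_z: "norm z = 1"
proof -
  have "norm z ^ N = 1 ^ N"
    using root by (metis norm_one norm_power power_one)
  then show ?thesis
    using N_pos by (metis norm_ge_zero power_eq_imp_eq_base zero_le_one)
qed

lemma power_mult_N [simp]: "z ^ (N * k) = 1" "z ^ (k * N) = 1"
  by (simp_all add: power_mult root mult.commute[of k])

lemma power_choose_N: "z ^ (N choose 2) = 1"
proof -
  obtain d where "N = 2 * d + 1"
    using odd_N oddE by blast
  then have "(N choose 2) = N * d"
    by (simp add: choose_two)
  then show ?thesis by simp
qed

lemma qpoch_self_nonzero:
  assumes "k < N"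
  shows "qpoch z z k \<noteq> 0"
  unfolding qpoch_def using primitive[of "Suc _"] assms by (simp add: eq_commute[of "1::complex"])

lemma qpoch_self_N: "qpoch z z N = 0"
proof -
  have "z * z ^ (N - 1) = 1"
    using root N_pos by (metis Suc_diff_1 power_Suc)
  then show ?thesis
    using N_pos by (auto simp: qpoch_def intro!: bexI[of _ "N - 1"])
qed

text \<open>Here \<open>(q)_N\<close> vanishes, while the denominators do not.\<close>

lemma gauss_binom_N:
  assumes "0 < k" "k < N"
  shows "gauss_binom z N k = 0"
  using gauss_binom_exact[of k N z] qpoch_self_N qpoch_self_nonzero[of k] qpoch_self_nonzero[of "N - k"] assms
  by auto

lemma qpoch_N: "qpoch x z N = 1 - x ^ N"
proof -
  have "qpoch x z N = (\<Sum>k\<in>{0, N}. gauss_binom z N k * ((-x) ^ k * z ^ (k choose 2)))"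
    unfolding qpoch_eq_sum_gauss_binom by (rule sum.mono_neutral_right) (auto simp: gauss_binom_N)
  then show ?thesis
    using N_pos odd_N power_choose_N by (simp add: numeral_2_eq_2)
qed

text \<open>The case of q-Lucas that adds a single period. It propagates along Pascal's rule because
  \<open>z ^ k = z ^ (k - N)\<close>.\<close>

lemma gauss_binom_add_N:
  "gauss_binom z (n + N) k = gauss_binom z n k + (if N \<le> k then gauss_binom z n (k - N) else 0)"
proof (induction n arbitrary: k)
  case 0
  have "gauss_binom z 0 k = (if k = 0 then 1 else 0)" for k
    by simp
  moreover have "gauss_binom z N k = (if k = 0 \<or> k = N then 1 else 0)"
    using gauss_binom_N[of k] by (cases k N rule: linorder_cases) auto
  ultimately show ?case
    using N_pos by auto
next
  case (Suc n)
  show ?case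
  proof (cases k)
    case k: (Suc j)
    have *: "gauss_binom z (Suc n + N) k = gauss_binom z (n + N) j + z ^ k * gauss_binom z (n + N) k"
      by (simp add: k gauss_binom_Suc_Suc)
    show ?thesis
    proof (cases "N \<le> k")
      case True
      have zk: "z ^ k = z ^ (k - N)"
        using True root by (metis le_add_diff_inverse mult_1 power_add)
      show ?thesis
      proof (cases "k = N")
        case True
        then have "gauss_binom z (Suc n) N = gauss_binom z n j + z ^ N * gauss_binom z n N"
          using gauss_binom_Suc_Suc[of z n j] k by simp
        then show ?thesis
          unfolding * Suc.IH using root k True by simp
      next
        case False
        then obtain l where l: "j - N = l" "k - N = Suc l" "N \<le> j" "N \<le> k"
          using True k by (metis Suc_diff_le le_neq_implies_less less_Suc_eq_le)
        then show ?thesis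
          unfolding * Suc.IH using zk k
          by (auto simp: gauss_binom_Suc_Suc algebra_simps)
      qed
    next
      case False
      then show ?thesis
        unfolding * Suc.IH using k by (simp add: gauss_binom_Suc_Suc)
    qed
  qed (use N_pos in simp)
qed

text \<open>The factor that the deformed inner sums gain when the top index increases by one period.\<close>

primrec block_ratio :: "complex \<Rightarrow> nat \<Rightarrow> complex" where
  "block_ratio y 0 = 1 / (1 + y ^ N)"
| "block_ratio y (Suc i) = 1 + y ^ (2 * N) * block_ratio y i"

lemma chain_beta_add_N: "chain_beta z y i (n + N) = block_ratio y i * chain_beta z y i n"
proof (induction i arbitrary: n)
  case 0
  have "qpoch (- (z * y)) z (n + N) = qpoch (- (z * y)) z n * (1 + y ^ N)"
    using odd_N by (simp add: qpoch_add qpoch_N power_mult_distrib root power_mult[symmetric])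
  then show ?case
    by (simp add: chain_beta_def)
next
  case (Suc i)
  define w where "w j = (z * y\<^sup>2) ^ j * z ^ j\<^sup>2" for j
  have w: "w (j + N) = y ^ (2 * N) * w j" for j
  proof -
    have "(j + N)\<^sup>2 = j\<^sup>2 + N * (2 * j + N)"
      by (simp add: power2_eq_square algebra_simps)
    then show ?thesis
      by (simp add: w_def power_add power_mult_distrib root power_mult[symmetric] mult_ac)
  qed
  have S: "chain_beta z y (Suc i) n = (\<Sum>j\<le>n. gauss_binom z n j * w j * chain_beta z y i j)" for n
    by (simp add: chain_beta_def w_def)
  have "chain_beta z y (Suc i) (n + N) = (\<Sum>j\<le>n + N. gauss_binom z n j * w j * chain_beta z y i j)
      + (\<Sum>j\<le>n + N. (if N \<le> j then gauss_binom z n (j - N) else 0) * w j * chain_beta z y i j)"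
    unfolding S gauss_binom_add_N by (simp add: algebra_simps sum.distrib)
  also have "(\<Sum>j\<le>n + N. gauss_binom z n j * w j * chain_beta z y i j) = chain_beta z y (Suc i) n"
    unfolding S by (rule sum.mono_neutral_right) auto
  also have "(\<Sum>j\<le>n + N. (if N \<le> j then gauss_binom z n (j - N) else 0) * w j * chain_beta z y i j)
      = (\<Sum>j\<in>{N..n + N}. gauss_binom z n (j - N) * w j * chain_beta z y i j)"
    by (rule sum.mono_neutral_cong_right) auto
  also have "\<dots> = (\<Sum>j\<le>n. gauss_binom z n j * w (j + N) * chain_beta z y i (j + N))"
    by (rule sum.reindex_bij_witness[where i = "\<lambda>j. j + N" and j = "\<lambda>j. j - N"]) auto
  also have "\<dots> = y ^ (2 * N) * block_ratio y i * chain_beta z y (Suc i) n"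
    unfolding S w Suc.IH by (simp add: sum_distrib_left mult_ac)
  finally show ?case
    by (simp add: algebra_simps)
qed

text \<open>Oddness of \<open>N\<close> enters twice: it makes \<open>z ^ (N choose 2)\<close> equal to \<open>1\<close>, and it gives the sign.\<close>

lemma psi_summand_add_N: "psi_summand z y i (n + N) = - (y ^ (2 * N) * block_ratio y i) * psi_summand z y i n"
proof -
  have "(Suc (n + N) choose 2) = (Suc n choose 2) + (N choose 2) + Suc n * N"
    using choose_2_add[of "Suc n" N] by simp
  then have "z ^ (Suc (n + N) choose 2) = z ^ (Suc n choose 2)"
    by (simp only: power_add power_choose_N power_mult_N mult_1_right)
  moreover have "(-1) ^ (n + N) = - ((-1) ^ n :: complex)"
    using odd_N by (simp add: power_add)
  moreover have "y ^ (2 * (n + N)) = y ^ (2 * N) * y ^ (2 * n)"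
    by (simp add: power_add distrib_left)
  ultimately show ?thesis
    by (simp add: psi_summand_def chain_beta_add_N mult_ac)
qed

lemma z_power_theta_exp_add_N: "z ^ theta_exp i (r + N) = z ^ theta_exp i r"
proof -
  have "theta_exp i (r + N)
      = theta_exp i r + (N choose 2) + N * (Suc i * (2 * r + N + 1) + r)"
    by (simp add: theta_exp_def choose_2_add power2_eq_square algebra_simps)
  then show ?thesis
    by (simp only: power_add power_choose_N power_mult_N mult_1_right)
qed

lemma theta_term_add_N: "theta_term z y i (r + N) = y ^ ((2 * i + 3) * N) * theta_term z y i r"
proof -
  have "z ^ (2 * (r + N) + 1) = z ^ (2 * r + 1)"
    by (simp add: power_add distrib_left)
  moreover have "y ^ ((2 * i + 3) * (r + N)) = y ^ ((2 * i + 3) * N) * y ^ ((2 * i + 3) * r)"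
    by (simp add: power_add[symmetric] algebra_simps)
  ultimately show ?thesis
    unfolding theta_term_def z_power_theta_exp_add_N by (simp only: mult_ac)
qed

text \<open>A convergent series whose terms are multiplied by \<open>c\<close> in each period is a geometric series of
  its first block.\<close>

lemma suminf_block:
  fixes f :: "nat \<Rightarrow> complex"
  assumes "summable f" "\<And>n. f (n + N) = c * f n"
  shows "(1 - c) * suminf f = (\<Sum>n<N. f n)"
proof -
  have "suminf f = (\<Sum>n. f (n + N)) + (\<Sum>n<N. f n)"
    using assms(1) by (rule suminf_split_initial_segment)
  also have "(\<Sum>n. f (n + N)) = c * suminf f"
    unfolding assms(2) using assms(1) by (rule suminf_mult)
  finally have "suminf f = c * suminf f + (\<Sum>n<N. f n)" .
  then show ?thesis
    by algebra
qed

end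

section \<open>The identity on the unit circle\<close>

lemma tendsto_gauss_binom [tendsto_intros]:
  "(q \<longlongrightarrow> a) F \<Longrightarrow> ((\<lambda>x. gauss_binom (q x) n k) \<longlongrightarrow> gauss_binom a n k) F"
  unfolding gauss_binom_def by (rule tendsto_poly)

lemma tendsto_qpoch [tendsto_intros]:
  fixes x q :: "'a \<Rightarrow> complex"
  shows "(x \<longlongrightarrow> a) F \<Longrightarrow> (q \<longlongrightarrow> b) F \<Longrightarrow> ((\<lambda>s. qpoch (x s) (q s) n) \<longlongrightarrow> qpoch a b n) F"
  unfolding qpoch_def by (intro tendsto_intros)

lemma tendsto_chain_beta:
  assumes "(q \<longlongrightarrow> a) F" "\<And>n. qpoch (- (a * y)) a n \<noteq> 0"
  shows "((\<lambda>s. chain_beta (q s) y i n) \<longlongrightarrow> chain_beta a y i n) F"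
proof (induction i arbitrary: n)
  case 0
  show ?case
    unfolding chain_beta_def kernel_chain.simps by (intro tendsto_intros assms)
next
  case (Suc i)
  show ?case
    using Suc unfolding chain_beta_def kernel_chain.simps by (intro tendsto_intros assms)
qed

text \<open>For \<open>q\<close> in the closed unit disk the summands on both sides are dominated by geometric series with
  ratios independent of \<open>q\<close>, provided that \<open>y\<close> is small enough to beat the growth \<open>(i + 2) ^ n\<close> of
  the inner sums. Tannery's theorem then carries the identity from the disk to its boundary.\<close>

lemma false_theta_identity_unit_circle:
  assumes z: "norm z = 1" and y: "norm y \<le> 1 / (real i + 3)"
  shows "summable (psi_summand z y i)" "summable (theta_term z y i)"
    "(\<Sum>n. psi_summand z y i n) = (\<Sum>r. theta_term z y i r)"
proof -
  define \<rho> where "\<rho> = (norm y)\<^sup>2 * (real i + 2)"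
  have y2: "norm y \<le> 1 / 2"
    using y by (rule order_trans) (simp add: field_simps)
  have "(norm y)\<^sup>2 \<le> (1 / (real i + 3))\<^sup>2"
    using y by (rule power_mono) simp
  then have "\<rho> \<le> (1 / (real i + 3))\<^sup>2 * (real i + 2)"
    unfolding \<rho>_def by (rule mult_right_mono) simp
  also have "\<dots> < 1"
    by (simp add: power_divide divide_simps power2_eq_square)
       (simp add: algebra_simps add_pos_nonneg)
  finally have \<rho>: "0 \<le> \<rho>" "\<rho> < 1"
    by (simp_all add: \<rho>_def)
  have qy: "norm (q * y) \<le> 1 / 2" if "norm q \<le> 1" for q
    using that y2 mult_mono[of "norm q" 1 "norm y" "1 / 2"] by (simp add: norm_mult)
  have b: "norm (psi_summand q y i n) \<le> \<rho> ^ n" if q: "norm q \<le> 1" for q n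
  proof -
    have "norm (chain_beta q y i n) \<le> (1 / (1 - norm (q * y)) + real i) ^ n"
      using q y2 qy[OF q] by (intro norm_chain_beta_le) auto
    also have "\<dots> \<le> (2 + real i) ^ n"
      using qy[OF q] by (intro power_mono add_right_mono) (auto simp: divide_simps)
    finally have 1: "norm (chain_beta q y i n) \<le> (2 + real i) ^ n" .
    have "norm (psi_summand q y i n) = norm q ^ (Suc n choose 2) * (norm y ^ (2 * n) * norm (chain_beta q y i n))"
      by (simp add: psi_summand_def norm_mult norm_power)
    also have "\<dots> \<le> 1 * (norm y ^ (2 * n) * (2 + real i) ^ n)"
      using q 1 by (intro mult_mono power_le_one order_refl) auto
    finally show ?thesis
      by (simp add: \<rho>_def power_mult_distrib power_mult add.commute)
  qed
  have t: "norm (theta_term q y i n) \<le> 2 * (1 / 2) ^ n" if q: "norm q \<le> 1" for q n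
  proof -
    have "norm (y\<^sup>2 * q ^ (2 * n + 1)) \<le> 1"
      using q y2 by (simp add: norm_mult norm_power power_le_one mult_le_one)
    then have "norm (1 - y\<^sup>2 * q ^ (2 * n + 1)) \<le> 2"
      using norm_triangle_ineq4[of 1 "y\<^sup>2 * q ^ (2 * n + 1)"] by simp
    moreover have "norm y ^ ((2 * i + 3) * n) \<le> (1 / 2) ^ n"
    proof -
      have "norm y ^ ((2 * i + 3) * n) \<le> norm y ^ n"
        using y2 by (intro power_decreasing) auto
      also have "\<dots> \<le> (1 / 2) ^ n"
        using y2 by (intro power_mono) auto
      finally show ?thesis .
    qed
    ultimately have "norm y ^ ((2 * i + 3) * n) * norm q ^ theta_exp i n * norm (1 - y\<^sup>2 * q ^ (2 * n + 1))
        \<le> (1 / 2) ^ n * 1 * 2"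
      using q by (intro mult_mono power_le_one) auto
    then show ?thesis
      by (simp add: theta_term_def norm_mult norm_power mult_ac)
  qed
  have \<rho>s: "summable (\<lambda>n. \<rho> ^ n)" and hs: "summable (\<lambda>n. 2 * (1 / 2 :: real) ^ n)"
    using \<rho> by (auto intro!: summable_geometric summable_mult)
  show "summable (psi_summand z y i)" "summable (theta_term z y i)"
    using summable_comparison_test'[OF \<rho>s b] summable_comparison_test'[OF hs t] z by auto
  define q where "q s = of_real s * z" for s :: real
  have q: "(q \<longlongrightarrow> z) (at_left 1)"
    unfolding q_def by (rule tendsto_eq_intros refl)+ simp
  have ev: "eventually (\<lambda>s. norm (q s) < 1) (at_left 1)"
    unfolding eventually_at_left_field q_def using z by (intro exI[of _ 0]) (auto simp: norm_mult)
  have nz: "qpoch (- (z * y)) z n \<noteq> 0" for n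
    using qy[of z] z by (intro qpoch_nonzero) auto
  have lim_b: "((\<lambda>s. \<Sum>n. psi_summand (q s) y i n) \<longlongrightarrow> (\<Sum>n. psi_summand z y i n)) (at_left 1)"
  proof (rule tannerys_theorem[THEN conjunct2, THEN conjunct2])
    show "((\<lambda>s. psi_summand (q s) y i n) \<longlongrightarrow> psi_summand z y i n) (at_left 1)" for n
      unfolding psi_summand_def by (intro tendsto_intros tendsto_chain_beta q nz)
    show "\<forall>\<^sub>F (n, s) in at_top \<times>\<^sub>F at_left 1. norm (psi_summand (q s) y i n) \<le> \<rho> ^ n"
      using eventually_prodI[OF always_eventually[of "\<lambda>_. True"] ev, of at_top] b
      by (auto elim!: eventually_mono)
  qed (use \<rho>s in auto)
  have lim_t: "((\<lambda>s. \<Sum>n. theta_term (q s) y i n) \<longlongrightarrow> (\<Sum>n. theta_term z y i n)) (at_left 1)"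
  proof (rule tannerys_theorem[THEN conjunct2, THEN conjunct2])
    show "((\<lambda>s. theta_term (q s) y i n) \<longlongrightarrow> theta_term z y i n) (at_left 1)" for n
      unfolding theta_term_def by (intro tendsto_intros q)
    show "\<forall>\<^sub>F (n, s) in at_top \<times>\<^sub>F at_left 1. norm (theta_term (q s) y i n) \<le> 2 * (1 / 2) ^ n"
      using eventually_prodI[OF always_eventually[of "\<lambda>_. True"] ev, of at_top] t
      by (auto elim!: eventually_mono)
  qed (use hs in auto)
  have "eventually (\<lambda>s. (\<Sum>n. psi_summand (q s) y i n) = (\<Sum>n. theta_term (q s) y i n)) (at_left 1)"
    using ev y2 by (auto elim!: eventually_mono intro!: false_theta_identity)
  from tendsto_cong[OF this, THEN iffD1, OF lim_b]
  show "(\<Sum>n. psi_summand z y i n) = (\<Sum>r. theta_term z y i r)"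
    by (rule tendsto_unique[OF trivial_limit_at_left_real _ lim_t])
qed

section \<open>Continuation in the deformation parameter\<close>

context odd_root_of_unity
begin

text \<open>The complement of the poles of the seed and of the block ratio.\<close>

abbreviation regular :: "complex set" where
  "regular \<equiv> {y. y ^ N \<noteq> -1}"

lemma block_identity_small:
  assumes "norm y \<le> 1 / (real i + 3)"
  shows "(\<Sum>n<N. psi_summand z y i n) * (1 - y ^ ((2 * i + 3) * N))
       = (1 + y ^ (2 * N) * block_ratio y i) * (\<Sum>r<N. theta_term z y i r)"
proof -
  note id = false_theta_identity_unit_circle[OF norm_z assms]
  define S where "S = (\<Sum>r. theta_term z y i r)"
  have "(1 + y ^ (2 * N) * block_ratio y i) * S = (\<Sum>n<N. psi_summand z y i n)"
    using suminf_block[OF id(1) psi_summand_add_N] id(3) by (simp add: S_def)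
  moreover have "(1 - y ^ ((2 * i + 3) * N)) * S = (\<Sum>r<N. theta_term z y i r)"
    using suminf_block[OF id(2) theta_term_add_N] by (simp add: S_def)
  ultimately show ?thesis
    by (metis mult.assoc mult.commute)
qed

lemma open_regular: "open regular" and connected_regular: "connected regular"
proof -
  have eq: "regular = UNIV - {y. y ^ N = -1}"
    by auto
  have fin: "finite {y :: complex. y ^ N = -1}"
    using N_pos by (intro finite_nth_roots)
  show "open regular"
    unfolding eq using fin by (intro open_Diff finite_imp_closed) auto
  show "connected regular"
    unfolding eq using fin by (intro connected_open_delete_finite) auto
qed

lemma qpoch_regular_nonzero:
  assumes "y \<in> regular"
  shows "qpoch (- (z * y)) z n \<noteq> 0"
proof
  assume "qpoch (- (z * y)) z n = 0"
  then obtain j where "1 + z * y * z ^ j = 0"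
    by (auto simp: qpoch_def)
  then have "y * z ^ Suc j = -1"
    by (simp add: eq_neg_iff_add_eq_0 mult_ac add.commute)
  then have "(y * z ^ Suc j) ^ N = -1"
    using odd_N by simp
  then have "y ^ N = -1"
    by (simp only: power_mult_distrib power_mult[symmetric] power_mult_N mult_1_right)
  then show False
    using assms by simp
qed

lemma holomorphic_chain_beta: "(\<lambda>y. chain_beta z y i n) holomorphic_on regular"
proof (induction i arbitrary: n)
  case 0
  have "(\<lambda>y. qpoch (- (z * y)) z n) holomorphic_on regular"
    unfolding qpoch_def by (intro holomorphic_intros)
  then show ?case
    unfolding chain_beta_def kernel_chain.simps
    by (intro holomorphic_intros) (use qpoch_regular_nonzero in auto)
next
  case (Suc i)
  then show ?case
    unfolding chain_beta_def kernel_chain.simps by (intro holomorphic_intros)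
qed

lemma holomorphic_block_ratio: "(\<lambda>y. block_ratio y i) holomorphic_on regular"
proof (induction i)
  case 0
  have "1 + y ^ N \<noteq> 0" if "y \<in> regular" for y
    using that by (simp add: add_eq_0_iff)
  then show ?case
    unfolding block_ratio.simps by (intro holomorphic_intros) auto
next
  case (Suc i)
  then show ?case
    unfolding block_ratio.simps by (intro holomorphic_intros)
qed

lemma holomorphic_psi_summand: "(\<lambda>y. \<Sum>n<N. psi_summand z y i n) holomorphic_on regular"
  unfolding psi_summand_def by (intro holomorphic_intros holomorphic_chain_beta)

text \<open>Both sides are holomorphic away from finitely many points and agree near \<open>0\<close>.\<close>

lemma block_identity:
  assumes "y \<in> regular"
  shows "(\<Sum>n<N. psi_summand z y i n) * (1 - y ^ ((2 * i + 3) * N))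
       = (1 + y ^ (2 * N) * block_ratio y i) * (\<Sum>r<N. theta_term z y i r)"
proof -
  define f where "f y = (\<Sum>n<N. psi_summand z y i n) * (1 - y ^ ((2 * i + 3) * N))
       - (1 + y ^ (2 * N) * block_ratio y i) * (\<Sum>r<N. theta_term z y i r)" for y
  define U where "U = ball (0 :: complex) (1 / (real i + 3))"
  have "f holomorphic_on regular"
    unfolding f_def theta_term_def
    by (intro holomorphic_intros holomorphic_psi_summand holomorphic_block_ratio)
  moreover have "U \<subseteq> regular"
  proof
    fix y assume "y \<in> U"
    then have "norm y < 1 / (real i + 3)"
      by (simp add: U_def)
    also have "\<dots> \<le> 1"
      by simp
    finally have "norm (y ^ N) < 1"
      using N_pos by (simp add: norm_power power_less_one_iff)
    then show "y \<in> regular"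
      by auto
  qed
  moreover have "0 \<in> regular"
    using N_pos by (simp add: power_0_left)
  moreover have "0 islimpt U"
    unfolding U_def by (subst islimpt_ball) auto
  moreover have "f y = 0" if "y \<in> U" for y
    using that block_identity_small[of y i] by (simp add: f_def U_def)
  ultimately have "f y = 0"
    using analytic_continuation[OF _ open_regular connected_regular] assms by blast
  then show ?thesis
    by (simp add: f_def)
qed

lemma block_ratio_one: "block_ratio 1 i = of_nat i + 1 / 2"
  by (induction i) simp_all

text \<open>At \<open>y = 1\<close> the left-hand side of the block identity vanishes, whereas the first factor on the
  right-hand side is \<open>(2 i + 3) / 2\<close>.\<close>

lemma sum_theta_term_one: "(\<Sum>r<N. theta_term z 1 i r) = 0"
proof -
  have "1 + block_ratio 1 i = of_nat (2 * i + 3) / 2"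
    by (simp add: block_ratio_one field_simps)
  also have "\<dots> \<noteq> 0"
    using of_nat_eq_0_iff[of "2 * i + 3", where ?'a = complex] by simp
  finally show ?thesis
    using block_identity[of 1 i] by simp
qed

text \<open>The derivative of the block identity at \<open>y = 1\<close>. By the product rule only the derivatives
  of the vanishing factors matter, so the derivatives of the inner sums and of the
  block ratio need only exist.\<close>

lemma sum_psi_summand_one:
  "(\<Sum>n<N. psi_summand z 1 i n) * (2 * of_nat N)
     = (\<Sum>r<N. 2 * z ^ (theta_exp i r + 2 * r + 1)
          - of_nat ((2 * i + 3) * r) * (z ^ theta_exp i r * (1 - z ^ (2 * r + 1))))"
proof -
  define K where "K = 2 * i + 3"
  define b where "b y = (\<Sum>n<N. psi_summand z y i n)" for y
  define A where "A y = 1 + y ^ (2 * N) * block_ratio y i" for y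
  define P where "P y = (\<Sum>r<N. theta_term z y i r)" for y
  define P' where "P' = (\<Sum>r<N. of_nat (K * r) * (z ^ theta_exp i r * (1 - z ^ (2 * r + 1)))
      - 2 * z ^ (theta_exp i r + 2 * r + 1))"
  have one: "1 \<in> regular"
    by simp
  have "b holomorphic_on regular" "A holomorphic_on regular"
    unfolding b_def[abs_def] A_def[abs_def]
    by (intro holomorphic_intros holomorphic_psi_summand holomorphic_block_ratio)+
  then obtain b' A' where b': "(b has_field_derivative b') (at 1)"
      and A': "(A has_field_derivative A') (at 1)"
    using one open_regular by (meson holomorphic_on_imp_differentiable_at field_differentiable_def)
  have P': "(P has_field_derivative P') (at 1)"
    unfolding P_def[abs_def] P'_def theta_term_def K_def[symmetric]
    by (rule derivative_eq_intros refl | simp add: power_add algebra_simps)+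
  have "((\<lambda>y. b y * (1 - y ^ (K * N))) has_field_derivative (- of_nat (K * N) * b 1)) (at 1)"
    by (rule derivative_eq_intros b' refl | simp)+
  moreover have "((\<lambda>y. A y * P y) has_field_derivative (A 1 * P')) (at 1)"
    using DERIV_mult[OF A' P'] sum_theta_term_one[of i] by (simp add: P_def mult.commute)
  then have "((\<lambda>y. b y * (1 - y ^ (K * N))) has_field_derivative (A 1 * P')) (at 1)"
    by (rule has_field_derivative_transform_within_open[OF _ open_regular one])
       (use block_identity in \<open>simp add: A_def P_def b_def K_def\<close>)
  ultimately have "- of_nat (K * N) * b 1 = A 1 * P'"
    by (rule DERIV_unique)
  then have e: "- (of_nat K * of_nat N) * b 1 = A 1 * P'"
    by simp
  have "A 1 * 2 = of_nat K"
    by (simp add: A_def block_ratio_one K_def field_simps)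
  with e have "of_nat K * (b 1 * (2 * of_nat N)) = of_nat K * (- P')"
    by algebra
  moreover have "of_nat K \<noteq> (0::complex)"
    unfolding of_nat_eq_0_iff by (simp add: K_def)
  ultimately have "b 1 * (2 * of_nat N) = - P'"
    by (metis mult_left_cancel)
  then show ?thesis
    by (simp add: b_def P'_def K_def sum_negf[symmetric])
qed

end

section \<open>Radial limits of false theta functions\<close>

lemma periodic_mult:
  fixes f :: "nat \<Rightarrow> 'a"
  assumes "\<And>n. f (n + N) = f n"
  shows "f (r + k * N) = f r"
proof (induction k)
  case (Suc k)
  show ?case
    using assms[of "r + k * N"] Suc by (simp add: add_ac)
qed simp

lemma periodic_bounded:
  fixes f :: "nat \<Rightarrow> 'a::real_normed_vector"
  assumes "0 < N" "\<And>n. f (n + N) = f n"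
  obtains B where "0 \<le> B" "\<And>n. norm (f n) \<le> B"
proof
  show "0 \<le> (\<Sum>r<N. norm (f r))"
    by (intro sum_nonneg) auto
  show "norm (f n) \<le> (\<Sum>r<N. norm (f r))" for n
  proof -
    have "f n = f (n mod N)"
      using periodic_mult[of f N "n mod N" "n div N"] assms(2) by simp
    then show ?thesis
      using assms(1) by (auto intro!: member_le_sum)
  qed
qed

lemma periodic_partial_sums:
  fixes w :: "nat \<Rightarrow> 'a::ab_group_add"
  assumes "\<And>n. w (n + N) = w n" "(\<Sum>r<N. w r) = 0"
  shows "(\<Sum>j<n + N. w j) = (\<Sum>j<n. w j)"
  using assms by (induction n) simp_all

lemma sums_by_parts:
  fixes U :: "nat \<Rightarrow> complex" and p :: "nat \<Rightarrow> real"
  assumes U: "\<And>n. norm (U n) \<le> B" "U 0 = 0" and p: "p \<longlonglongrightarrow> 0"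
    and s: "summable (\<lambda>n. \<bar>p n - p (Suc n)\<bar>)"
  shows "(\<lambda>n. (U (Suc n) - U n) * of_real (p n)) sums (\<Sum>n. U (Suc n) * of_real (p n - p (Suc n)))"
    and "norm (\<Sum>n. U (Suc n) * of_real (p n - p (Suc n))) \<le> B * (\<Sum>n. \<bar>p n - p (Suc n)\<bar>)"
proof -
  have B: "norm (U (Suc n) * of_real (p n - p (Suc n))) \<le> B * \<bar>p n - p (Suc n)\<bar>" for n
    using U(1)[of "Suc n"] by (auto simp: norm_mult simp flip: of_real_diff intro!: mult_right_mono)
  have sB: "summable (\<lambda>n. B * \<bar>p n - p (Suc n)\<bar>)"
    using s by (rule summable_mult)
  have sn: "summable (\<lambda>n. norm (U (Suc n) * of_real (p n - p (Suc n))))"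
    using B by (intro summable_comparison_test'[OF sB]) simp
  have "(\<lambda>n. U n * of_real (p n)) \<longlonglongrightarrow> 0"
  proof (rule Lim_null_comparison)
    show "(\<lambda>n. B * \<bar>p n\<bar>) \<longlonglongrightarrow> 0"
      using tendsto_mult[OF tendsto_const tendsto_rabs[OF p], of B] by simp
    show "\<forall>\<^sub>F n in sequentially. norm (U n * of_real (p n)) \<le> B * \<bar>p n\<bar>"
      by (intro always_eventually allI) (auto simp: norm_mult intro!: mult_right_mono U(1))
  qed
  from telescope_sums[OF this] have "(\<lambda>n. U (Suc n) * of_real (p (Suc n)) - U n * of_real (p n)) sums 0"
    by (simp add: U(2))
  from sums_add[OF summable_sums[OF summable_norm_cancel[OF sn]] this]
  show "(\<lambda>n. (U (Suc n) - U n) * of_real (p n)) sums (\<Sum>n. U (Suc n) * of_real (p n - p (Suc n)))"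
    by (simp add: algebra_simps)
  have "norm (\<Sum>n. U (Suc n) * of_real (p n - p (Suc n)))
      \<le> (\<Sum>n. norm (U (Suc n) * of_real (p n - p (Suc n))))"
    using sn by (rule summable_norm)
  also have "\<dots> \<le> (\<Sum>n. B * \<bar>p n - p (Suc n)\<bar>)"
    by (rule suminf_le[OF B sn sB])
  also have "\<dots> = B * (\<Sum>n. \<bar>p n - p (Suc n)\<bar>)"
    using s by (rule suminf_mult)
  finally show "norm (\<Sum>n. U (Suc n) * of_real (p n - p (Suc n))) \<le> B * (\<Sum>n. \<bar>p n - p (Suc n)\<bar>)" .
qed

text \<open>If a family of weights has total mass \<open>1\<close> and total variation tending to \<open>0\<close>, then a periodic
  sequence is averaged in the limit: the deviation from its mean has bounded partial sums, and
  summation by parts moves the difference to the weights.\<close>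

lemma periodic_equidistribution:
  fixes V :: "nat \<Rightarrow> complex" and p :: "real \<Rightarrow> nat \<Rightarrow> real"
  assumes N: "0 < N" and V: "\<And>n. V (n + N) = V n"
    and p: "eventually (\<lambda>t. p t sums 1 \<and> summable (\<lambda>n. \<bar>p t n - p t (Suc n)\<bar>)
              \<and> (\<Sum>n. \<bar>p t n - p t (Suc n)\<bar>) \<le> \<epsilon> t) F"
    and \<epsilon>: "(\<epsilon> \<longlongrightarrow> 0) F"
  shows "((\<lambda>t. \<Sum>n. V n * of_real (p t n)) \<longlongrightarrow> (\<Sum>n<N. V n) / of_nat N) F"
proof -
  define \<mu> where "\<mu> = (\<Sum>n<N. V n) / of_nat N"
  define U where "U n = (\<Sum>j<n. V j - \<mu>)" for n
  have "(\<Sum>j<N. V j - \<mu>) = 0"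
    using N by (simp add: sum_subtractf \<mu>_def)
  then have "U (n + N) = U n" for n
    unfolding U_def by (intro periodic_partial_sums) (simp_all add: V)
  then obtain B where B: "0 \<le> B" "\<And>n. norm (U n) \<le> B"
    using periodic_bounded[of N U] N by blast
  have "eventually (\<lambda>t. norm ((\<Sum>n. V n * of_real (p t n)) - \<mu>) \<le> B * \<epsilon> t) F"
    using p
  proof (rule eventually_mono)
    fix t assume t: "p t sums 1 \<and> summable (\<lambda>n. \<bar>p t n - p t (Suc n)\<bar>)
              \<and> (\<Sum>n. \<bar>p t n - p t (Suc n)\<bar>) \<le> \<epsilon> t"
    then have p0: "p t \<longlonglongrightarrow> 0"
      using summable_LIMSEQ_zero sums_summable by blast
    define R where "R = (\<Sum>n. U (Suc n) * of_real (p t n - p t (Suc n)))"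
    have R: "(\<lambda>n. (V n - \<mu>) * of_real (p t n)) sums R" "norm R \<le> B * \<epsilon> t"
    proof -
      have "U (Suc n) - U n = V n - \<mu>" for n
        by (simp add: U_def)
      then show "(\<lambda>n. (V n - \<mu>) * of_real (p t n)) sums R"
        using sums_by_parts(1)[of U B "p t"] B p0 t by (simp add: R_def U_def)
      have "norm R \<le> B * (\<Sum>n. \<bar>p t n - p t (Suc n)\<bar>)"
        using sums_by_parts(2)[of U B "p t"] B p0 t by (simp add: R_def U_def)
      also have "\<dots> \<le> B * \<epsilon> t"
        using t B by (intro mult_left_mono) auto
      finally show "norm R \<le> B * \<epsilon> t" .
    qed
    have "(\<lambda>n. \<mu> * of_real (p t n)) sums (\<mu> * of_real 1)"
      using t by (intro sums_mult sums_of_real) auto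
    from sums_add[OF R(1) this] have "(\<lambda>n. V n * of_real (p t n)) sums (R + \<mu>)"
      by (simp add: algebra_simps)
    then show "norm ((\<Sum>n. V n * of_real (p t n)) - \<mu>) \<le> B * \<epsilon> t"
      using R(2) by (simp add: sums_iff)
  qed
  moreover have "((\<lambda>t. B * \<epsilon> t) \<longlongrightarrow> 0) F"
    using tendsto_mult[OF tendsto_const \<epsilon>, of B] by simp
  ultimately have "((\<lambda>t. (\<Sum>n. V n * of_real (p t n)) - \<mu>) \<longlongrightarrow> 0) F"
    by (rule Lim_null_comparison)
  then show ?thesis
    unfolding \<mu>_def[symmetric] by (simp add: LIM_zero_iff)
qed

text \<open>The difference of consecutive exponents of the false theta function.\<close>

definition theta_diff :: "nat \<Rightarrow> nat \<Rightarrow> nat" where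
  "theta_diff i n = (2 * i + 3) * n + 2 * i + 2"

lemma theta_exp_Suc: "theta_exp i (Suc n) = theta_exp i n + theta_diff i n"
  by (simp add: theta_exp_def theta_diff_def Suc_choose_2 power2_eq_square algebra_simps)

lemma theta_exp_ge: "n\<^sup>2 \<le> theta_exp i n"
  by (simp add: theta_exp_def)

lemma theta_diff_sq_le: "(theta_diff i n)\<^sup>2 \<le> 2 * (2 * i + 3)\<^sup>2 * (theta_exp i n + 1)"
proof -
  have "theta_diff i n \<le> (2 * i + 3) * (n + 1)"
    by (simp add: theta_diff_def algebra_simps)
  then have "(theta_diff i n)\<^sup>2 \<le> ((2 * i + 3) * (n + 1))\<^sup>2"
    by (rule power_mono) simp
  also have "\<dots> = (2 * i + 3)\<^sup>2 * (n + 1)\<^sup>2"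
    by (rule power_mult_distrib)
  also have "(n + 1)\<^sup>2 \<le> 2 * (n\<^sup>2 + 1)"
  proof -
    have "int ((n + 1)\<^sup>2) \<le> int (2 * (n\<^sup>2 + 1))"
      using zero_le_power2[of "int n - 1"] by (simp add: power2_eq_square algebra_simps)
    then show ?thesis by linarith
  qed
  also have "\<dots> \<le> 2 * (theta_exp i n + 1)"
    using theta_exp_ge[of n i] by simp
  finally show ?thesis
    by (simp add: mult_ac)
qed

text \<open>The weights of the false theta function on the radius at \<open>|q| = exp (- t)\<close>. All error
  terms below are bounded by multiples of \<open>t * exp (- t e(n) / 2)\<close>: the loss of half the exponent pays
  for a factor \<open>t e(n) + 1\<close>.\<close>

definition gauss_weight :: "nat \<Rightarrow> real \<Rightarrow> nat \<Rightarrow> real" where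
  "gauss_weight i t n = exp (- (t * theta_exp i n))"

lemma exp_half_bound:
  fixes s :: real
  assumes "0 \<le> s"
  shows "exp (- s) * (s + 1) \<le> 2 * exp (- (s / 2))"
proof -
  have "s + 1 \<le> 2 * exp (s / 2)"
    using exp_ge_add_one_self[of "s / 2"] assms by linarith
  then have "exp (- s) * (s + 1) \<le> exp (- s) * (2 * exp (s / 2))"
    by (intro mult_left_mono) auto
  also have "\<dots> = 2 * exp (- (s / 2))"
    by (simp add: exp_add[symmetric])
  finally show ?thesis .
qed

text \<open>From \<open>2 s n \<le> s\<^sup>2 n\<^sup>2 + 1\<close> with \<open>s = sqrt t\<close> the Gaussian weight is dominated by a geometric sequence
  with ratio \<open>exp (- s)\<close>; its sum is of order \<open>1 / s\<close>, so the factor \<open>t = s\<^sup>2\<close> makes the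
  bound tend to \<open>0\<close> with \<open>t\<close>.\<close>

lemma sums_half_gauss_weight_bound:
  fixes t :: real
  assumes t: "0 < t"
  shows "summable (\<lambda>n. t * exp (- (t * theta_exp i n / 2)))"
    "(\<Sum>n. t * exp (- (t * theta_exp i n / 2))) \<le> exp (1 / 2) * (sqrt t + t)"
proof -
  define s where "s = sqrt t"
  have s: "0 < s" "t = s\<^sup>2"
    using t by (simp_all add: s_def)
  have le: "t * exp (- (t * theta_exp i n / 2)) \<le> t * exp (1 / 2) * exp (- s) ^ n" for n
  proof -
    have "real n ^ 2 \<le> real (theta_exp i n)"
      using theta_exp_ge[of n i] by (metis of_nat_le_iff of_nat_power)
    then have "t * (real n)\<^sup>2 \<le> t * theta_exp i n"
      using t by (intro mult_left_mono) auto
    moreover have "2 * (s * n) \<le> t * (real n)\<^sup>2 + 1"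
      using zero_le_power2[of "s * n - 1"] by (simp add: s(2) power2_eq_square algebra_simps)
    ultimately have "- (t * theta_exp i n / 2) \<le> 1 / 2 + of_nat n * (- s)"
      by (simp add: mult.commute)
    then have "exp (- (t * theta_exp i n / 2)) \<le> exp (1 / 2) * exp (- s) ^ n"
      by (metis exp_add exp_le_cancel_iff exp_of_nat_mult)
    then show ?thesis
      using t by (simp add: mult.assoc)
  qed
  have g: "(\<lambda>n. t * exp (1 / 2) * exp (- s) ^ n) sums (t * exp (1 / 2) * (1 / (1 - exp (- s))))"
    using s by (intro sums_mult geometric_sums) simp
  show sm: "summable (\<lambda>n. t * exp (- (t * theta_exp i n / 2)))"
    using t le by (intro summable_comparison_test'[OF sums_summable[OF g]]) simp
  have "(\<Sum>n. t * exp (- (t * theta_exp i n / 2))) \<le> t * exp (1 / 2) * (1 / (1 - exp (- s)))"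
    using suminf_le[OF le sm sums_summable[OF g]] g by (simp add: sums_iff)
  also have "\<dots> \<le> t * exp (1 / 2) * ((1 + s) / s)"
  proof (intro mult_left_mono)
    have "exp (- s) \<le> 1 / (1 + s)"
      using exp_ge_add_one_self[of s] s by (simp add: exp_minus field_simps)
    then have "s / (1 + s) \<le> 1 - exp (- s)"
      using s by (simp add: field_simps)
    then have "1 / (1 - exp (- s)) \<le> 1 / (s / (1 + s))"
      using s by (intro divide_left_mono) (auto intro!: mult_pos_pos)
    then show "1 / (1 - exp (- s)) \<le> (1 + s) / s"
      by simp
  qed (use t in auto)
  also have "\<dots> = exp (1 / 2) * (sqrt t + t)"
    using s by (simp add: power2_eq_square s_def[symmetric] field_simps)
  finally show "(\<Sum>n. t * exp (- (t * theta_exp i n / 2))) \<le> exp (1 / 2) * (sqrt t + t)" .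
qed

lemma one_minus_exp_bounds:
  fixes x :: real
  assumes "0 \<le> x"
  shows "0 \<le> 1 - exp (- x)" "1 - exp (- x) \<le> x" "\<bar>1 - exp (- x) - x\<bar> \<le> x\<^sup>2"
proof -
  show 1: "0 \<le> 1 - exp (- x)" and 2: "1 - exp (- x) \<le> x"
    using assms exp_ge_add_one_self[of "- x"] by auto
  have "exp (- x) \<le> 1 / (1 + x)"
    using exp_ge_add_one_self[of x] assms by (simp add: exp_minus field_simps)
  also have "\<dots> \<le> 1 - x + x\<^sup>2"
    using assms by (simp add: field_simps power2_eq_square)
  finally show "\<bar>1 - exp (- x) - x\<bar> \<le> x\<^sup>2"
    using 2 by simp
qed

context
  fixes i :: nat and t :: real
  assumes t: "0 < t" "t \<le> 1"
begin

lemma gauss_weight_sq_bound: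
  "gauss_weight i t n * (t * theta_diff i n)\<^sup>2 \<le> 4 * (2 * i + 3)\<^sup>2 * (t * exp (- (t * theta_exp i n / 2)))"
proof -
  define E where "E = real (theta_exp i n)"
  define K where "K = real (2 * i + 3)"
  have "(real (theta_diff i n))\<^sup>2 \<le> 2 * K\<^sup>2 * (E + 1)"
    using theta_diff_sq_le[of i n] unfolding E_def K_def
    by (metis (mono_tags, lifting) of_nat_1 of_nat_add of_nat_le_iff of_nat_mult of_nat_numeral of_nat_power)
  then have "gauss_weight i t n * (t\<^sup>2 * (real (theta_diff i n))\<^sup>2) \<le> gauss_weight i t n * (t\<^sup>2 * (2 * K\<^sup>2 * (E + 1)))"
    by (intro mult_left_mono) (auto simp: gauss_weight_def)
  also have "\<dots> = 2 * K\<^sup>2 * t * (gauss_weight i t n * (t * E + t))"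
    by (simp add: power2_eq_square algebra_simps)
  also have "\<dots> \<le> 2 * K\<^sup>2 * t * (gauss_weight i t n * (t * E + 1))"
    using t by (intro mult_left_mono) (auto simp: gauss_weight_def)
  also have "\<dots> \<le> 2 * K\<^sup>2 * t * (2 * exp (- (t * E / 2)))"
    using t exp_half_bound[of "t * E"] by (intro mult_left_mono) (auto simp: gauss_weight_def E_def)
  finally show ?thesis
    by (simp add: E_def K_def power_mult_distrib mult_ac)
qed

lemma gauss_weight_le: "gauss_weight i t n * t \<le> t * exp (- (t * theta_exp i n / 2))"
  using t by (simp add: gauss_weight_def)

lemma gauss_weight_diff: "gauss_weight i t n - gauss_weight i t (Suc n) = gauss_weight i t n * (1 - exp (- (t * theta_diff i n)))"
  by (simp add: gauss_weight_def theta_exp_Suc algebra_simps exp_add[symmetric])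

text \<open>This bounds the total variation of the first differences of the weights.\<close>

lemma gauss_weight_second_diff_bound:
  "\<bar>(gauss_weight i t n - gauss_weight i t (Suc n)) - (gauss_weight i t (Suc n) - gauss_weight i t (Suc (Suc n)))\<bar>
     \<le> 5 * (2 * i + 3)\<^sup>2 * (t * exp (- (t * theta_exp i n / 2)))"
proof -
  define K where "K = real (2 * i + 3)"
  define x where "x = t * theta_diff i n"
  have x: "0 \<le> x"
    using t by (simp add: x_def)
  have "gauss_weight i t (Suc n) = gauss_weight i t n * exp (- x)"
    by (simp add: x_def gauss_weight_def theta_exp_Suc algebra_simps exp_add[symmetric])
  moreover have "real (theta_diff i (Suc n)) = theta_diff i n + K"
    by (simp add: theta_diff_def K_def)
  \<comment> \<open>With \<open>X = exp (- x)\<close> the second difference is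
    \<open>1 - 2 X + X\<^sup>2 exp (- t K) = (1 - X)\<^sup>2 - X\<^sup>2 (1 - exp (- t K))\<close> times the weight.\<close>
  ultimately have "(gauss_weight i t n - gauss_weight i t (Suc n)) - (gauss_weight i t (Suc n) - gauss_weight i t (Suc (Suc n)))
      = gauss_weight i t n * ((1 - exp (- x))\<^sup>2 - exp (- x) ^ 2 * (1 - exp (- (t * K))))"
    unfolding gauss_weight_diff by (simp add: x_def algebra_simps power2_eq_square exp_add[symmetric] exp_double)
  also have "\<bar>\<dots>\<bar> \<le> gauss_weight i t n * (x\<^sup>2 + t * K)"
  proof -
    have "(1 - exp (- x))\<^sup>2 \<le> x\<^sup>2"
      using one_minus_exp_bounds[OF x] by (intro power_mono) auto
    moreover have "exp (- x) ^ 2 * (1 - exp (- (t * K))) \<le> 1 * (t * K)"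
      using one_minus_exp_bounds[of "t * K"] t x by (intro mult_mono power_le_one) (auto simp: K_def)
    moreover have "0 \<le> exp (- x) ^ 2 * (1 - exp (- (t * K)))"
      using one_minus_exp_bounds[of "t * K"] t by (auto simp: K_def)
    moreover have "0 \<le> (1 - exp (- x))\<^sup>2" "0 \<le> x\<^sup>2" "0 \<le> t * K"
      using t by (simp_all add: K_def)
    ultimately have "\<bar>(1 - exp (- x))\<^sup>2 - exp (- x) ^ 2 * (1 - exp (- (t * K)))\<bar> \<le> x\<^sup>2 + t * K"
      by linarith
    then show ?thesis
      unfolding abs_mult by (intro mult_mono) (auto simp: gauss_weight_def)
  qed
  also have "\<dots> \<le> 4 * K\<^sup>2 * (t * exp (- (t * theta_exp i n / 2))) + K * (t * exp (- (t * theta_exp i n / 2)))"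
    using gauss_weight_sq_bound[of n] mult_left_mono[OF gauss_weight_le[of n], of K]
    by (simp add: x_def K_def algebra_simps)
  also have "\<dots> \<le> 4 * K\<^sup>2 * (t * exp (- (t * theta_exp i n / 2))) + K\<^sup>2 * (t * exp (- (t * theta_exp i n / 2)))"
    using t by (intro add_left_mono mult_right_mono) (auto simp: K_def self_le_power)
  finally show ?thesis
    by (simp add: K_def algebra_simps)
qed

text \<open>The exponents \<open>2 n + 1\<close> and \<open>theta_diff i n\<close> are proportional up to a bounded error, with
  ratio \<open>2 / (2 i + 3)\<close>. Hence the second part of a false theta term may be replaced by a multiple of
  the first difference of the weights.\<close>

lemma gauss_weight_linear_bound:
  "\<bar>gauss_weight i t n * (1 - exp (- (t * (2 * n + 1)))) - 2 / (2 * i + 3) * (gauss_weight i t n - gauss_weight i t (Suc n))\<bar>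
     \<le> 9 * (2 * i + 3)\<^sup>2 * (t * exp (- (t * theta_exp i n / 2)))"
proof -
  define K where "K = real (2 * i + 3)"
  define d where "d = real (theta_diff i n)"
  define x where "x = t * real (2 * n + 1)"
  define y where "y = t * d"
  have K: "3 \<le> K" "d = K * n + K - 1"
    by (simp_all add: K_def d_def theta_diff_def)
  have xy: "0 \<le> x" "0 \<le> y"
    using t by (simp_all add: x_def y_def d_def)
  have "x \<le> y"
    unfolding x_def y_def d_def using t by (intro mult_left_mono of_nat_mono) (auto simp: theta_diff_def algebra_simps)
  then have x2: "x\<^sup>2 \<le> y\<^sup>2"
    using xy by (intro power_mono) auto
  have "x - 2 / K * y = t * (2 / K - 1)"
    unfolding x_def y_def K(2) using K(1) by (simp add: field_simps)
  then have lin: "\<bar>x - 2 / K * y\<bar> \<le> t"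
    using t K by (simp add: abs_mult mult_left_le abs_le_iff)
  have "\<bar>(1 - exp (- x)) - 2 / K * (1 - exp (- y))\<bar>
      \<le> \<bar>1 - exp (- x) - x\<bar> + \<bar>x - 2 / K * y\<bar> + 2 / K * \<bar>1 - exp (- y) - y\<bar>"
  proof -
    have "a - c * b = (a - x) + (x - c * y) - c * (b - y)" for a b c :: real
      by (simp add: algebra_simps)
    then have "(1 - exp (- x)) - 2 / K * (1 - exp (- y))
        = (1 - exp (- x) - x) + (x - 2 / K * y) - 2 / K * (1 - exp (- y) - y)" .
    moreover have "\<bar>2 / K * (1 - exp (- y) - y)\<bar> = 2 / K * \<bar>1 - exp (- y) - y\<bar>"
      unfolding abs_mult using K by simp
    ultimately show ?thesis by linarith
  qed
  also have "\<dots> \<le> y\<^sup>2 + t + 1 * y\<^sup>2"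
    using one_minus_exp_bounds(3)[OF xy(1)] one_minus_exp_bounds(3)[OF xy(2)] x2 lin K
    by (intro add_mono mult_mono) auto
  finally have b: "\<bar>(1 - exp (- x)) - 2 / K * (1 - exp (- y))\<bar> \<le> 2 * y\<^sup>2 + t"
    by simp
  have "gauss_weight i t n * (1 - exp (- x)) - 2 / K * (gauss_weight i t n - gauss_weight i t (Suc n))
      = gauss_weight i t n * ((1 - exp (- x)) - 2 / K * (1 - exp (- y)))"
    unfolding gauss_weight_diff by (simp add: y_def d_def algebra_simps)
  also have "\<bar>\<dots>\<bar> \<le> gauss_weight i t n * (2 * y\<^sup>2 + t)"
    unfolding abs_mult using b by (intro mult_mono) (auto simp: gauss_weight_def)
  also have "\<dots> \<le> 8 * K\<^sup>2 * (t * exp (- (t * theta_exp i n / 2))) + 1 * (t * exp (- (t * theta_exp i n / 2)))"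
    using gauss_weight_sq_bound[of n] gauss_weight_le[of n] by (simp add: y_def d_def K_def algebra_simps)
  also have "\<dots> \<le> 8 * K\<^sup>2 * (t * exp (- (t * theta_exp i n / 2))) + K\<^sup>2 * (t * exp (- (t * theta_exp i n / 2)))"
    using t K by (intro add_left_mono mult_right_mono one_le_power) auto
  finally show ?thesis
    by (simp add: K_def x_def algebra_simps)
qed

lemma gauss_weight_tendsto_0: "gauss_weight i t \<longlonglongrightarrow> 0"
proof (rule Lim_null_comparison)
  show "(\<lambda>n. exp (- (t * theta_exp i n / 2))) \<longlonglongrightarrow> 0"
    using tendsto_mult[OF tendsto_const summable_LIMSEQ_zero[OF sums_half_gauss_weight_bound(1)[OF t(1), of i]], of "1 / t"] t
    by simp
  show "\<forall>\<^sub>F n in sequentially. norm (gauss_weight i t n) \<le> exp (- (t * theta_exp i n / 2))"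
    using t by (auto simp: gauss_weight_def)
qed

lemma gauss_weight_diff_nonneg: "0 \<le> gauss_weight i t n - gauss_weight i t (Suc n)"
  using one_minus_exp_bounds(1)[of "t * theta_diff i n"] t unfolding gauss_weight_diff by (simp add: gauss_weight_def)

lemma gauss_weight_diff_sums: "(\<lambda>n. gauss_weight i t n - gauss_weight i t (Suc n)) sums 1"
proof -
  have "gauss_weight i t 0 = 1"
    by (simp add: gauss_weight_def theta_exp_def numeral_2_eq_2)
  then show ?thesis
    using telescope_sums'[OF gauss_weight_tendsto_0] by simp
qed

end

lemma sum_partial_sums:
  fixes w :: "nat \<Rightarrow> complex"
  shows "(\<Sum>n<M. \<Sum>j\<le>n. w j) = of_nat M * (\<Sum>j<M. w j) - (\<Sum>j<M. of_nat j * w j)"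
  by (induction M) (simp_all add: lessThan_Suc_atMost[symmetric] algebra_simps)

text \<open>Summation by parts in the part with \<open>w\<close>, whose partial sums are periodic, and the linear bound in
  the part with \<open>v\<close> reduce both to a periodic sequence \<open>V\<close> weighted by the first
  differences of the weights. These have total mass \<open>1\<close> and small variation, so the limit is the
  mean of \<open>V\<close>.\<close>

lemma periodic_gaussian_limit:
  fixes w v :: "nat \<Rightarrow> complex"
  assumes N: "0 < N" and w: "\<And>n. w (n + N) = w n" "(\<Sum>r<N. w r) = 0" and v: "\<And>n. v (n + N) = v n"
  shows "((\<lambda>t. \<Sum>n. of_real (gauss_weight i t n) * (w n + v n * (1 - of_real (exp (- (t * real (2 * n + 1)))))))
     \<longlongrightarrow> (2 / of_nat (2 * i + 3) * (\<Sum>r<N. v r) - (\<Sum>r<N. of_nat r * w r)) / of_nat N) (at_right 0)"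
    (is "((\<lambda>t. \<Sum>n. ?s t n) \<longlongrightarrow> ?L) _")
proof -
  define c where "c = 2 / real (2 * i + 3)"
  define U where "U n = (\<Sum>j<n. w j)" for n
  define V where "V n = U (Suc n) + of_real c * v n" for n
  define p where "p t n = gauss_weight i t n - gauss_weight i t (Suc n)" for t n
  define C where "C = 9 * (real (2 * i + 3))\<^sup>2"
  define g where "g t n = t * exp (- (t * theta_exp i n / 2))" for t :: real and n
  define \<epsilon> where "\<epsilon> t = C * (exp (1 / 2) * (sqrt t + t))" for t
  have U_per: "U (n + N) = U n" for n
    unfolding U_def using w by (rule periodic_partial_sums)
  obtain B where B: "0 \<le> B" "\<And>n. norm (U n) \<le> B"
    using periodic_bounded[of N U] N U_per by blast
  obtain B' where B': "0 \<le> B'" "\<And>n. norm (v n) \<le> B'"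
    using periodic_bounded[of N v] N v by blast
  have C: "0 \<le> C"
    by (simp add: C_def)
  have "(\<epsilon> \<longlongrightarrow> C * (exp (1 / 2) * (sqrt 0 + 0))) (at_right 0)"
    unfolding \<epsilon>_def[abs_def] by (intro tendsto_intros)
  then have \<epsilon>: "(\<epsilon> \<longlongrightarrow> 0) (at_right 0)"
    by simp
  have small: "eventually (\<lambda>t::real. 0 < t \<and> t \<le> 1) (at_right 0)"
    unfolding eventually_at_right_field by (intro exI[of _ 1]) auto
  have gs: "summable (\<lambda>n. C * g t n)" "(\<Sum>n. C * g t n) \<le> \<epsilon> t" if "0 < t" for t
    using sums_half_gauss_weight_bound[OF that, of i] C
    by (auto simp: g_def \<epsilon>_def suminf_mult intro!: summable_mult mult_left_mono)
  have "((\<lambda>t. \<Sum>n. V n * of_real (p t n)) \<longlongrightarrow> (\<Sum>n<N. V n) / of_nat N) (at_right 0)"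
  proof (rule periodic_equidistribution[OF N _ _ \<epsilon>])
    show "V (n + N) = V n" for n
      using U_per[of "Suc n"] v by (simp add: V_def)
    show "\<forall>\<^sub>F t in at_right 0. p t sums 1 \<and> summable (\<lambda>n. \<bar>p t n - p t (Suc n)\<bar>)
        \<and> (\<Sum>n. \<bar>p t n - p t (Suc n)\<bar>) \<le> \<epsilon> t"
      using small
    proof (rule eventually_mono)
      fix t :: real assume t: "0 < t \<and> t \<le> 1"
      have le: "\<bar>p t n - p t (Suc n)\<bar> \<le> C * g t n" for n
      proof -
        have "\<bar>p t n - p t (Suc n)\<bar> \<le> 5 * (2 * i + 3)\<^sup>2 * g t n"
          unfolding p_def g_def using t by (intro gauss_weight_second_diff_bound) auto
        also have "\<dots> \<le> C * g t n"
          using t unfolding C_def g_def by (intro mult_right_mono) auto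
        finally show ?thesis .
      qed
      have s: "summable (\<lambda>n. \<bar>p t n - p t (Suc n)\<bar>)"
        using le t by (intro summable_comparison_test'[OF gs(1)]) auto
      have "(\<Sum>n. \<bar>p t n - p t (Suc n)\<bar>) \<le> (\<Sum>n. C * g t n)"
        using t by (intro suminf_le[OF le s gs(1)]) auto
      also have "\<dots> \<le> \<epsilon> t"
        using t by (intro gs(2)) auto
      finally show "p t sums 1 \<and> summable (\<lambda>n. \<bar>p t n - p t (Suc n)\<bar>)
          \<and> (\<Sum>n. \<bar>p t n - p t (Suc n)\<bar>) \<le> \<epsilon> t"
        using s gauss_weight_diff_sums[of t i] t by (simp add: p_def[abs_def])
    qed
  qed
  moreover have "((\<lambda>t. (\<Sum>n. ?s t n) - (\<Sum>n. V n * of_real (p t n))) \<longlongrightarrow> 0) (at_right 0)"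
  proof (rule Lim_null_comparison)
    show "((\<lambda>t. B' * \<epsilon> t) \<longlongrightarrow> 0) (at_right 0)"
      using tendsto_mult[OF tendsto_const \<epsilon>, of B'] by simp
    show "\<forall>\<^sub>F t in at_right 0. norm ((\<Sum>n. ?s t n) - (\<Sum>n. V n * of_real (p t n))) \<le> B' * \<epsilon> t"
      using small
    proof (rule eventually_mono)
      fix t :: real assume t: "0 < t \<and> t \<le> 1"
      define R where "R n = gauss_weight i t n * (1 - exp (- (t * real (2 * n + 1)))) - c * p t n" for n
      have R: "\<bar>R n\<bar> \<le> C * g t n" for n
        using gauss_weight_linear_bound[of t i n] t by (simp add: R_def c_def p_def C_def g_def add.commute)
      have p: "p t sums 1" "\<And>n. \<bar>p t n\<bar> = p t n" "\<And>n. 0 \<le> p t n"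
        using gauss_weight_diff_sums[of t i] gauss_weight_diff_nonneg[of t i] t by (simp_all add: p_def[abs_def])
      have 1: "(\<lambda>n. w n * of_real (gauss_weight i t n)) sums (\<Sum>n. U (Suc n) * of_real (p t n))"
      proof -
        have "(\<lambda>n. (U (Suc n) - U n) * of_real (gauss_weight i t n)) sums (\<Sum>n. U (Suc n) * of_real (gauss_weight i t n - gauss_weight i t (Suc n)))"
        proof (rule sums_by_parts(1)[of U B])
          show "summable (\<lambda>n. \<bar>gauss_weight i t n - gauss_weight i t (Suc n)\<bar>)"
            using sums_summable[OF p(1)] p(2) by (simp add: p_def[abs_def])
        qed (use B(2) gauss_weight_tendsto_0[of t i] t in \<open>auto simp: U_def\<close>)
        then show ?thesis
          by (simp add: U_def p_def)
      qed
      have U: "summable (\<lambda>n. U (Suc n) * of_real (p t n))"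
        using B(2) p by (intro summable_comparison_test'[OF summable_mult[OF sums_summable[OF p(1)], of B]])
          (auto simp: norm_mult intro!: mult_right_mono)
      have v: "summable (\<lambda>n. v n * of_real (c * p t n))"
      proof (rule summable_comparison_test')
        show "summable (\<lambda>n. B' * (c * p t n))"
          using p(1) by (intro summable_mult) (rule sums_summable)
        show "norm (v n * of_real (c * p t n)) \<le> B' * (c * p t n)" for n
        proof -
          have "0 \<le> c * p t n"
            using p(3)[of n] by (simp add: c_def)
          then show ?thesis
            unfolding norm_mult[of "v n"] norm_of_real using B' by (intro mult_mono) auto
        qed
      qed
      have R': "norm (v n * of_real (R n)) \<le> B' * (C * g t n)" for n
        unfolding norm_mult using B' R by (intro mult_mono) auto
      have sR: "summable (\<lambda>n. B' * (C * g t n))"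
        using t by (intro summable_mult[of "\<lambda>n. C * g t n"] gs(1)) simp
      have R_sum: "summable (\<lambda>n. norm (v n * of_real (R n)))"
        using R' by (intro summable_comparison_test'[OF sR]) simp
      have "(\<lambda>n. w n * of_real (gauss_weight i t n) + v n * of_real (c * p t n) + v n * of_real (R n))
          sums ((\<Sum>n. U (Suc n) * of_real (p t n)) + (\<Sum>n. v n * of_real (c * p t n)) + (\<Sum>n. v n * of_real (R n)))"
        by (intro sums_add 1 summable_sums v summable_norm_cancel[OF R_sum])
      also have "(\<lambda>n. w n * of_real (gauss_weight i t n) + v n * of_real (c * p t n) + v n * of_real (R n)) = ?s t"
        by (simp add: fun_eq_iff R_def algebra_simps)
      also have "(\<Sum>n. U (Suc n) * of_real (p t n)) + (\<Sum>n. v n * of_real (c * p t n))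
          = (\<Sum>n. V n * of_real (p t n))"
        using suminf_add[OF U v] by (simp add: V_def algebra_simps)
      finally have "(\<Sum>n. ?s t n) - (\<Sum>n. V n * of_real (p t n)) = (\<Sum>n. v n * of_real (R n))"
        by (simp add: sums_iff)
      also have "norm \<dots> \<le> (\<Sum>n. norm (v n * of_real (R n)))"
        by (rule summable_norm[OF R_sum])
      also have "\<dots> \<le> (\<Sum>n. B' * (C * g t n))"
        by (rule suminf_le[OF R' R_sum sR])
      also have "\<dots> = B' * (\<Sum>n. C * g t n)"
        using t by (intro suminf_mult gs(1)) simp
      also have "\<dots> \<le> B' * \<epsilon> t"
        using t B' by (intro mult_left_mono gs(2)) simp_all
      finally show "norm ((\<Sum>n. ?s t n) - (\<Sum>n. V n * of_real (p t n))) \<le> B' * \<epsilon> t" .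
    qed
  qed
  ultimately have "((\<lambda>t. (\<Sum>n. ?s t n)) \<longlongrightarrow> (\<Sum>n<N. V n) / of_nat N) (at_right 0)"
    using tendsto_add by fastforce
  moreover have "(\<Sum>n<N. V n) / of_nat N = ?L"
    using sum_partial_sums[of w N] w(2)
    by (simp add: V_def U_def c_def sum.distrib sum_distrib_left lessThan_Suc_atMost)
  ultimately show ?thesis
    by simp
qed

context odd_root_of_unity
begin

text \<open>The limit of the false theta function is the same finite sum over one period that the
  derivative of the block identity produced.\<close>

lemma theta_limit:
  "((\<lambda>t. of_nat (2 * i + 3) / 2 * (\<Sum>r. theta_term (z * of_real (exp (- t))) 1 i r))
      \<longlongrightarrow> (\<Sum>n<N. psi_summand z 1 i n)) (at_right 0)"
proof -
  define w where "w r = z ^ theta_exp i r * (1 - z ^ (2 * r + 1))" for r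
  define v where "v r = z ^ (theta_exp i r + 2 * r + 1)" for r
  have per: "z ^ (2 * (r + N) + 1) = z ^ (2 * r + 1)" for r
    by (simp add: power_add distrib_left)
  have w: "w (r + N) = w r" for r
    unfolding w_def z_power_theta_exp_add_N per ..
  have v: "v (r + N) = v r" for r
    unfolding v_def add.assoc power_add[of z "theta_exp i _"] z_power_theta_exp_add_N per ..
  have w0: "(\<Sum>r<N. w r) = 0"
    using sum_theta_term_one[of i] by (simp add: theta_term_def w_def)
  have term_eq: "theta_term (z * of_real (exp (- t))) 1 i n
      = of_real (gauss_weight i t n) * (w n + v n * (1 - of_real (exp (- (t * real (2 * n + 1))))))" for t n
  proof -
    have e: "of_real (exp (- t)) ^ k = (of_real (exp (- (t * real k))) :: complex)" for k
      by (simp only: of_real_power[symmetric] exp_of_nat_mult[symmetric] mult_minus_left mult_minus_right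
          mult.commute[of t])
    show ?thesis
      unfolding theta_term_def power_mult_distrib e gauss_weight_def w_def v_def
      by (simp add: power_add algebra_simps)
  qed
  have "((\<lambda>t. of_nat (2 * i + 3) / 2 * (\<Sum>r. theta_term (z * of_real (exp (- t))) 1 i r))
      \<longlongrightarrow> of_nat (2 * i + 3) / 2 * ((2 / of_nat (2 * i + 3) * (\<Sum>r<N. v r) - (\<Sum>r<N. of_nat r * w r)) / of_nat N))
      (at_right 0)"
    unfolding term_eq by (intro tendsto_mult tendsto_const periodic_gaussian_limit N_pos w w0 v)
  also have "of_nat (2 * i + 3) / 2 * ((2 / of_nat (2 * i + 3) * (\<Sum>r<N. v r) - (\<Sum>r<N. of_nat r * w r)) / of_nat N)
      = (\<Sum>n<N. psi_summand z 1 i n)"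
  proof -
    have "(\<Sum>n<N. psi_summand z 1 i n) * (2 * of_nat N)
        = 2 * (\<Sum>r<N. v r) - of_nat (2 * i + 3) * (\<Sum>r<N. of_nat r * w r)"
      unfolding sum_psi_summand_one v_def w_def by (simp only: sum_subtractf sum_distrib_left of_nat_mult mult.assoc)
    moreover have "of_nat (2 * i + 3) \<noteq> (0 :: complex)" "of_nat N \<noteq> (0 :: complex)"
      unfolding of_nat_eq_0_iff using N_pos by auto
    moreover have "K / 2 * ((2 / K * a - b) / n) = s" if "s * (2 * n) = 2 * a - K * b" "K \<noteq> 0" "n \<noteq> 0"
      for K a b n s :: complex
    proof -
      have "K / 2 * ((2 / K * a - b) / n) = (2 * a - K * b) / (2 * n)"
        using that(2,3) by (simp add: field_simps)
      then show ?thesis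
        using that(3) unfolding that(1)[symmetric] by simp
    qed
    ultimately show ?thesis by blast
  qed
  finally show ?thesis .
qed

end

section \<open>The radial limit\<close>

lemma zeta_pow_odd_root:
  assumes "N \<ge> 1" "odd N" "coprime M (int N)"
  shows "odd_root_of_unity (zeta_pow N (of_int M)) N"
proof
  have pow: "zeta_pow N (of_int M) ^ j = exp (\<i> * of_real (2 * pi * (of_int M * of_nat j / of_nat N)))" for j
    by (simp add: zeta_pow_def qpow_def exp_of_nat_mult[symmetric] mult_ac)
  show "odd N" by fact
  show "zeta_pow N (of_int M) ^ N = 1"
    unfolding pow exp_eq_1 using assms(1) by (auto intro!: exI[of _ M])
  show "zeta_pow N (of_int M) ^ j \<noteq> 1" if "0 < j" "j < N" for j
  proof
    assume "zeta_pow N (of_int M) ^ j = 1"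
    then obtain k :: int where "2 * pi * (of_int M * of_nat j / of_nat N) = of_int (2 * k) * pi"
      unfolding pow exp_eq_1 by auto
    then have "real_of_int (M * int j) = real_of_int (k * int N)"
      using assms(1) by (simp add: field_simps)
    then have "M * int j = k * int N"
      by (simp only: of_int_eq_iff)
    then have "int N dvd M * int j"
      by simp
    then have "int N dvd int j"
      using assms(3) by (simp add: coprime_commute coprime_dvd_mult_right_iff)
    then show False
      using that by (auto dest: dvd_imp_le)
  qed
qed

theorem theorem3p3:
  fixes m N :: nat and M :: int
  assumes "m \<ge> 2" and "N \<ge> 1" and "odd N" and "coprime M (int N)"
  shows "((\<lambda>t::real. psi_tilde m (of_int M / of_nat N + \<i> * of_real (t / (2 * pi)))) \<longlongrightarrow>
           zeta_pow N (of_int M * (2 * real m - 3)\<^sup>2 / (8 * (2 * real m - 1)))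
             * Z m N (zeta_pow N (of_int M)))
         (at_right 0)"
proof -
  obtain i where m: "m = i + 2"
    using assms(1) by (metis add.commute le_Suc_ex)
  define z where "z = zeta_pow N (of_int M)"
  define \<tau> where "\<tau> t = of_int M / of_nat N + \<i> * of_real (t / (2 * pi))" for t :: real
  define \<rho> where "\<rho> = (2 * real m - 3)\<^sup>2 / (8 * (2 * real m - 1))"
  interpret odd_root_of_unity z N
    unfolding z_def using assms(2-4) by (rule zeta_pow_odd_root)
  have q: "qpow (\<tau> t) 1 = z * of_real (exp (- t))" for t
  proof -
    have "2 * of_real pi * \<i> * of_real 1 * \<tau> t
        = 2 * of_real pi * \<i> * of_real (of_int M) * (1 / of_nat N) + of_real (- t)"
      by (simp add: \<tau>_def complex_eq_iff)
    then show ?thesis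
      unfolding qpow_def z_def zeta_pow_def by (simp only: exp_add exp_of_real)
  qed
  have "((\<lambda>t. qpow (\<tau> t) \<rho>) \<longlongrightarrow> qpow (of_int M / of_nat N + \<i> * of_real (0 / (2 * pi))) \<rho>) (at_right 0)"
    unfolding qpow_def \<tau>_def by (intro tendsto_intros) simp
  also have "qpow (of_int M / of_nat N + \<i> * of_real (0 / (2 * pi))) \<rho> = zeta_pow N (of_int M * \<rho>)"
    by (simp add: zeta_pow_def qpow_def mult_ac)
  finally have pref: "((\<lambda>t. qpow (\<tau> t) \<rho>) \<longlongrightarrow> zeta_pow N (of_int M * \<rho>)) (at_right 0)" .
  have "eventually (\<lambda>t. qpow (\<tau> t) \<rho> * (of_nat (2 * i + 3) / 2 * (\<Sum>r. theta_term (z * of_real (exp (- t))) 1 i r))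
      = psi_tilde m (\<tau> t)) (at_right 0)"
    using eventually_at_right_less[of "0::real"]
  proof (rule eventually_mono)
    fix t :: real assume t: "0 < t"
    have nq: "norm (qpow (\<tau> t) 1) < 1"
      unfolding q using t norm_z by (simp add: norm_mult)
    have "psi_tilde m (\<tau> t) = of_real ((2 * real m - 1) / 2) * qpow (\<tau> t) \<rho>
        * (\<Sum>\<^sub>\<infinity>f\<in>{1..Suc i} \<rightarrow>\<^sub>E UNIV. psi_term (i + 2) (qpow (\<tau> t) 1) f)"
      by (simp add: psi_tilde_def \<rho>_def m)
    also have "\<dots> = of_real ((2 * real m - 1) / 2) * qpow (\<tau> t) \<rho> * (\<Sum>r. theta_term (qpow (\<tau> t) 1) 1 i r)"
      unfolding infsum_psi_term[OF nq] using false_theta_identity[OF nq, of 1] by simp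
    also have "of_real ((2 * real m - 1) / 2) = (of_nat (2 * i + 3) / 2 :: complex)"
      by (simp add: m)
    finally show "qpow (\<tau> t) \<rho> * (of_nat (2 * i + 3) / 2 * (\<Sum>r. theta_term (z * of_real (exp (- t))) 1 i r))
      = psi_tilde m (\<tau> t)"
      unfolding q by (simp add: mult_ac)
  qed
  moreover have "((\<lambda>t. qpow (\<tau> t) \<rho> * (of_nat (2 * i + 3) / 2 * (\<Sum>r. theta_term (z * of_real (exp (- t))) 1 i r)))
      \<longlongrightarrow> zeta_pow N (of_int M * \<rho>) * (\<Sum>n<N. psi_summand z 1 i n)) (at_right 0)"
    by (intro tendsto_mult pref theta_limit)
  ultimately have "((\<lambda>t. psi_tilde m (\<tau> t)) \<longlongrightarrow> zeta_pow N (of_int M * \<rho>) * Z m N z) (at_right 0)"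
    unfolding m Z_eq_sum_psi_summand by (rule Lim_transform_eventually[rotated])
  then show ?thesis
    by (simp add: \<tau>_def \<rho>_def z_def)
qed

end
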